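(* Let $p\ge 7$ be a prime. Then, modulo $p^4$ (in $\mathbb{Z}_p$): (i) if $n$ is an integer with $4\le 2n\le p-7$, $$A^\star_{2n}\equiv-A_{p-1-2n}+p^2w_p(1+pw_p)\mathcal{B}_{p-1-2n}-\frac{p^3w_p}{2}\,\mathcal{C}(p-1-2n);$$ (ii) $A^\star_2\equiv-A_{p-3}+p^2w_p\big(2\mathcal{B}_{p-3}-\mathcal{B}_{2p-4}\big)$; (iii) if moreover $p\ge 11$, $$A^\star_{p-5}\equiv\frac{1}{8}\Big(\frac{5p^3}{4}-\frac{p}{15}-\frac{p^2}{36}\Big)+\frac{p\,w_p}{120}\Big(\frac{7p^2}{12}-p\big(1+p\,(pB_{p-1})_1\big)\Big);$$ (iv) $A^\star_{p-3}\equiv\frac{1}{24}\Big(p(2p-1)(5p-2)+p\,w_p\big(2p-11p^2+2p^2(pB_{p-1})_1\big)\Big)$; (v) $A^\star_{p-1}\equiv-1+p\,w_p\Big(3(p\mathcal{B}_{p-1}-1)-p\mathcal{B}_{2(p-1)}-\frac{1}{2}p^2\mathcal{B}_{p-1}^2\Big)$.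
   Context: $A_k:=\sum_{1\le i_1<\dots<i_k\le p-1}i_1\cdots i_k$ and $A^\star_k:=\sum_{1\le i_1<\dots<i_k\le p-1}\frac{1}{i_1\cdots i_k}$ (multiple harmonic sum). $w_p:=\frac{(p-1)!+1}{p}$ is the Wilson quotient. $B_n$ is the $n$-th Bernoulli number, $\mathcal{B}_n:=B_n/n$, and for even $m\ge4$, $\mathcal{C}(m):=\sum_{i=2}^{m-2}\mathcal{B}_i\mathcal{B}_{m-i}$. $(pB_{p-1})_1$ denotes the Agoh–Giuga quotient $(pB_{p-1}+1)/p\in\mathbb{Z}_p$. $x\equiv y\pmod{p^4}$ means $x-y\in p^4\mathbb{Z}_p$. *)

theory Defs
  imports "HOL-Computational_Algebra.Computational_Algebra"
begin

(* All quantities below are rational. A rational lies in the p-adic integers Z_p iff its reduced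
   denominator is prime to p, so this is the intersection of Z_p with the rationals. *)
definition p_integers :: "nat \<Rightarrow> rat set" where
  "p_integers p = {x. \<not> int p dvd snd (quotient_of x)}"

(* x - y lies in p^k Z_p; the factor z is automatically rational. *)
definition padic_cong :: "nat \<Rightarrow> nat \<Rightarrow> rat \<Rightarrow> rat \<Rightarrow> bool" where
  "padic_cong p k x y \<longleftrightarrow> (\<exists>z\<in>p_integers p. x - y = of_nat p ^ k * z)"

(* Index tuples 1 <= i_1 < ... < i_k <= p - 1 are identified with k-element subsets of {1..p-1}. *)
definition A_sum :: "nat \<Rightarrow> nat \<Rightarrow> rat" where
  "A_sum p k = (\<Sum>I | I \<subseteq> {1..p-1} \<and> card I = k. \<Prod>i\<in>I. of_nat i)"

definition A_star :: "nat \<Rightarrow> nat \<Rightarrow> rat" where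
  "A_star p k = (\<Sum>I | I \<subseteq> {1..p-1} \<and> card I = k. 1 / (\<Prod>i\<in>I. of_nat i))"

definition wilson_quotient :: "nat \<Rightarrow> rat" where
  "wilson_quotient p = (fact (p - 1) + 1) / of_nat p"

(* Exponential generating function x / (e^x - 1), so that B_1 = -1/2. *)
definition bernoulli :: "nat \<Rightarrow> rat" where
  "bernoulli n = fact n * fps_nth (fps_X / (fps_exp 1 - 1)) n"

definition divided_bernoulli :: "nat \<Rightarrow> rat" where
  "divided_bernoulli n = bernoulli n / of_nat n"

definition bernoulli_convolution :: "nat \<Rightarrow> rat" where
  "bernoulli_convolution m = (\<Sum>i = 2..m-2. divided_bernoulli i * divided_bernoulli (m - i))"

definition agoh_giuga_quotient :: "nat \<Rightarrow> rat" where
  "agoh_giuga_quotient p = (of_nat p * bernoulli (p - 1) + 1) / of_nat p"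

end

theory Submission
  imports Defs "HOL-Number_Theory.Residues"
begin

text \<open>
  Since \<open>(p - 1)! = p w - 1\<close>, complementing index sets gives \<open>A\<^sup>\<star>\<^sub>k (1 - p w) = - A\<^sub>m\<close> with
  \<open>m = p - 1 - k\<close>, so everything reduces to \<open>A\<^sub>m\<close> modulo powers of \<open>p\<close>. Newton's identities
  express \<open>A\<^sub>m\<close> through power sums, which Faulhaber's formula expresses through Bernoulli numbers;
  for \<open>m = 2, 4\<close> one uses the exact polynomials in \<open>p\<close> instead.

  For (v), compare \<open>((p - 1)!)\<^bsup>p-1\<^esup> = \<Prod>(1 + x\<^sub>i)\<close>, \<open>x\<^sub>i = i\<^bsup>p-1\<^esup> - 1\<close>, with the power sums of exponents
  \<open>p - 1\<close> and \<open>2 (p - 1)\<close>.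

  For (ii), \<open>A\<^sup>\<star>\<^sub>2\<close> is \<open>- 1/2\<close> times the power sum \<open>S\<^sub>k\<close> of exponent \<open>k = -2\<close> modulo \<open>p\<^sup>3\<close>, and
  \<open>S\<^sub>k / (p k)\<close> has vanishing second difference modulo \<open>p\<^sup>2\<close> along \<open>k = -2, p - 3, 2 p - 4\<close>.
  This holds because doubling the summation variable gives
  \<open>(2\<^sup>k - 1) S\<^sub>k = \<Sum>((p + r)\<^sup>k - r\<^sup>k)\<close>, summed over odd \<open>r < p\<close>.
\<close>

section \<open>Elementary symmetric sums\<close>

text \<open>Stated over an arbitrary commutative ring and weight \<open>f\<close>, so that both the
  sums of products and the sums of reciprocals are instances and share Newton's identities.\<close>

definition esym :: "('a \<Rightarrow> 'b::comm_ring_1) \<Rightarrow> 'a set \<Rightarrow> nat \<Rightarrow> 'b" where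
  "esym f A k = (\<Sum>I | I \<subseteq> A \<and> card I = k. \<Prod>i\<in>I. f i)"

lemma esym_0 [simp]: "finite A \<Longrightarrow> esym f A 0 = 1"
proof -
  assume "finite A"
  then have "{I. I \<subseteq> A \<and> card I = 0} = {{}}"
    by (auto dest: finite_subset)
  then show ?thesis by (simp add: esym_def)
qed

lemma esym_empty_Suc [simp]:
  fixes f :: "'a \<Rightarrow> 'b::comm_ring_1"
  shows "esym f {} (Suc k) = 0"
proof -
  have "{I :: 'a set. I \<subseteq> {} \<and> card I = Suc k} = {}" by auto
  then show ?thesis by (simp only: esym_def sum.empty)
qed

lemma esym_insert:
  assumes "finite A" "a \<notin> A"
  shows "esym f (insert a A) (Suc k) = esym f A (Suc k) + f a * esym f A k"
proof -
  let ?N = "{I. I \<subseteq> A \<and> card I = Suc k}" and ?M = "{I. I \<subseteq> A \<and> card I = k}"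
  have fin: "finite I" if "I \<subseteq> A" for I
    using that assms(1) by (rule finite_subset)
  have "{I. I \<subseteq> insert a A \<and> card I = Suc k} = ?N \<union> insert a ` ?M"
  proof (intro equalityI subsetI)
    fix I assume I: "I \<in> {I. I \<subseteq> insert a A \<and> card I = Suc k}"
    then have "finite I" using assms(1) by (auto intro: finite_subset)
    show "I \<in> ?N \<union> insert a ` ?M"
    proof (cases "a \<in> I")
      case True
      then have "I = insert a (I - {a})" "card (I - {a}) = k" "I - {a} \<subseteq> A"
        using I \<open>finite I\<close> by auto
      then show ?thesis by blast
    next
      case False
      then show ?thesis using I by auto
    qed
  next
    fix I assume "I \<in> ?N \<union> insert a ` ?M"
    then show "I \<in> {I. I \<subseteq> insert a A \<and> card I = Suc k}"
      using assms(2) fin by (auto simp: subset_iff card_insert_if)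
  qed
  moreover have "finite ?N" "finite ?M" "?N \<inter> insert a ` ?M = {}"
    using assms by auto
  moreover have "inj_on (insert a) ?M"
    using assms(2) by (auto simp: inj_on_def)
  moreover have "(\<Prod>i\<in>insert a I. f i) = f a * (\<Prod>i\<in>I. f i)" if "I \<in> ?M" for I
    using that assms(2) fin by (subst prod.insert) auto
  ultimately show ?thesis
    by (simp add: esym_def sum.union_disjoint sum.reindex sum_distrib_left)
qed

lemma fps_nth_prod_esym:
  assumes "finite A"
  shows "fps_nth (\<Prod>a\<in>A. 1 + fps_const (f a) * fps_X) k = esym f A k"
  using assms
proof (induction A arbitrary: k rule: finite_induct)
  case empty
  then show ?case by (cases k) auto
next
  case (insert a A)
  then show ?case
    by (cases k) (auto simp: esym_insert distrib_right mult.assoc)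
qed

text \<open>Logarithmic derivative of the generating product \<open>P A\<close>: each factor
  contributes f a / (1 + f a X), and the geometric expansions of these, added over \<open>a\<close>,
  have the signed power sums as coefficients.\<close>

lemma esym_Newton:
  assumes "finite A"
  shows "of_nat (Suc n) * esym f A (Suc n) =
    (\<Sum>i\<le>n. esym f A (n - i) * ((-1) ^ i * (\<Sum>a\<in>A. f a ^ Suc i)))"
proof -
  define P where "P A = (\<Prod>a\<in>A. 1 + fps_const (f a) * fps_X)" for A
  define Q where "Q A = Abs_fps (\<lambda>i. (-1) ^ i * (\<Sum>a\<in>A. f a ^ Suc i))" for A
  \<comment> \<open>The geometric series in multiplied-out form, so that no power series has to be
    inverted.\<close>
  have geo: "(1 + fps_const c * fps_X) * Abs_fps (\<lambda>i. (-1) ^ i * c ^ Suc i) = fps_const c"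
    for c :: 'b
  proof (rule fps_ext)
    fix n show "fps_nth ((1 + fps_const c * fps_X) * Abs_fps (\<lambda>i. (-1) ^ i * c ^ Suc i)) n
        = fps_nth (fps_const c) n"
      by (cases n) (auto simp: distrib_right mult.assoc)
  qed
  have "fps_deriv (P A) = P A * Q A"
    using assms
  proof (induction A rule: finite_induct)
    case empty
    then show ?case by (auto simp: P_def Q_def fps_eq_iff fps_mult_nth)
  next
    case (insert a A)
    have P: "P (insert a A) = (1 + fps_const (f a) * fps_X) * P A"
      using insert by (simp add: P_def)
    have Q: "Q (insert a A) = Abs_fps (\<lambda>i. (-1) ^ i * f a ^ Suc i) + Q A"
      using insert by (simp add: Q_def fps_eq_iff distrib_left)
    have "fps_deriv (P (insert a A)) =
        fps_const (f a) * P A + (1 + fps_const (f a) * fps_X) * (P A * Q A)"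
      unfolding P by (simp add: insert.IH algebra_simps)
    also have "\<dots> = (1 + fps_const (f a) * fps_X) *
        Abs_fps (\<lambda>i. (-1) ^ i * f a ^ Suc i) * P A + (1 + fps_const (f a) * fps_X) * (P A * Q A)"
      by (simp only: geo)
    also have "\<dots> = P (insert a A) * Q (insert a A)"
      unfolding P Q by (simp only: algebra_simps)
    finally show ?case .
  qed
  then have "fps_nth (fps_deriv (P A)) n = fps_nth (Q A * P A) n"
    by (simp add: mult.commute)
  also have "\<dots> = (\<Sum>i\<le>n. fps_nth (P A) (n - i) * fps_nth (Q A) i)"
    unfolding fps_mult_nth atLeast0AtMost by (intro sum.cong refl mult.commute)
  finally show ?thesis
    using assms fps_nth_prod_esym[of A f] by (simp add: P_def Q_def)
qed

text \<open>Multiplying by the full product turns the reciprocal product over \<open>I\<close> into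
  the product over the complement of \<open>I\<close>.\<close>

lemma esym_inverse:
  fixes f :: "'a \<Rightarrow> 'b::field"
  assumes "finite A" "\<And>a. a \<in> A \<Longrightarrow> f a \<noteq> 0" "k \<le> card A"
  shows "esym (\<lambda>a. 1 / f a) A k * (\<Prod>a\<in>A. f a) = esym f A (card A - k)"
proof -
  have "(\<Prod>i\<in>I. 1 / f i) * (\<Prod>a\<in>A. f a) = (\<Prod>i\<in>A - I. f i)" if "I \<subseteq> A" for I
  proof -
    have "(\<Prod>a\<in>A. f a) = (\<Prod>i\<in>A - I. f i) * (\<Prod>i\<in>I. f i)"
      using prod.subset_diff[OF that assms(1)] .
    moreover have "(\<Prod>i\<in>I. f i) \<noteq> 0"
      using that assms by (subst prod_zero_iff) (auto dest: finite_subset)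
    ultimately show ?thesis by (simp add: prod_dividef)
  qed
  then have "esym (\<lambda>a. 1 / f a) A k * (\<Prod>a\<in>A. f a) =
      (\<Sum>I | I \<subseteq> A \<and> card I = k. \<Prod>i\<in>A - I. f i)"
    unfolding esym_def sum_distrib_right by (intro sum.cong) auto
  also have "\<dots> = esym f A (card A - k)"
    unfolding esym_def
    by (rule sum.reindex_bij_witness[of _ "\<lambda>I. A - I" "\<lambda>I. A - I"])
      (use assms in \<open>auto simp: card_Diff_subset finite_subset double_diff\<close>)
  finally show ?thesis .
qed

section \<open>Closed forms for the symmetric sums of 1, ..., n\<close>

lemma esym_upto_Suc:
  "esym (of_nat :: nat \<Rightarrow> 'b::comm_ring_1) {1..Suc n} (Suc k) =
    esym of_nat {1..n} (Suc k) + of_nat (Suc n) * esym of_nat {1..n} k"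
proof -
  have "{1..Suc n} = insert (Suc n) {1..n}" by auto
  then show ?thesis by (simp add: esym_insert)
qed

text \<open>These are unsigned Stirling numbers of the first kind, as polynomials in
  \<open>n\<close>. Each comes from the preceding one by induction on \<open>n\<close> through
  \<open>esym_upto_Suc\<close>.\<close>

lemma esym_upto:
  fixes x :: "nat \<Rightarrow> rat" defines "x \<equiv> of_nat"
  shows esym_upto_1: "esym of_nat {1..n} 1 = x n * (x n + 1) / 2"
    and esym_upto_2: "esym of_nat {1..n} 2 = (x n - 1) * x n * (x n + 1) * (3 * x n + 2) / 24"
    and esym_upto_3: "esym of_nat {1..n} 3 = (x n - 2) * (x n - 1) * (x n)^2 * (x n + 1)^2 / 48"
    and esym_upto_4: "esym of_nat {1..n} 4 = (x n - 3) * (x n - 2) * (x n - 1) * x n * (x n + 1) *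
      (15 * x n ^ 3 + 15 * x n ^ 2 - 10 * x n - 8) / 5760"
proof -
  have 1: "esym of_nat {1..n} (Suc 0) = x n * (x n + 1) / 2" for n
  proof (induction n)
    case (Suc n)
    show ?case unfolding esym_upto_Suc Suc esym_0[OF finite_atLeastAtMost] x_def
      by (simp add: field_simps power2_eq_square)
  qed (simp add: x_def)
  have 2: "esym of_nat {1..n} (Suc (Suc 0)) = (x n - 1) * x n * (x n + 1) * (3 * x n + 2) / 24" for n
  proof (induction n)
    case (Suc n)
    show ?case unfolding esym_upto_Suc Suc 1 unfolding x_def of_nat_Suc by (simp add: field_simps power2_eq_square power3_eq_cube)
  qed (simp add: x_def)
  have 3: "esym of_nat {1..n} (Suc (Suc (Suc 0))) = (x n - 2) * (x n - 1) * (x n)^2 * (x n + 1)^2 / 48" for n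
  proof (induction n)
    case (Suc n)
    show ?case unfolding esym_upto_Suc Suc 2 unfolding x_def of_nat_Suc by (simp add: field_simps power2_eq_square power3_eq_cube)
  qed (simp add: x_def)
  have 4: "esym of_nat {1..n} (Suc (Suc (Suc (Suc 0)))) = (x n - 3) * (x n - 2) * (x n - 1) * x n * (x n + 1) *
      (15 * x n ^ 3 + 15 * x n ^ 2 - 10 * x n - 8) / 5760" for n
  proof (induction n)
    case (Suc n)
    show ?case unfolding esym_upto_Suc Suc 3 unfolding x_def of_nat_Suc by (simp add: field_simps power2_eq_square power3_eq_cube)
  qed (simp add: x_def)
  show "esym of_nat {1..n} 1 = x n * (x n + 1) / 2"
    and "esym of_nat {1..n} 2 = (x n - 1) * x n * (x n + 1) * (3 * x n + 2) / 24"
    and "esym of_nat {1..n} 3 = (x n - 2) * (x n - 1) * (x n)^2 * (x n + 1)^2 / 48"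
    and "esym of_nat {1..n} 4 = (x n - 3) * (x n - 2) * (x n - 1) * x n * (x n + 1) *
      (15 * x n ^ 3 + 15 * x n ^ 2 - 10 * x n - 8) / 5760"
    using 1 2 3 4 by (simp_all add: eval_nat_numeral)
qed

section \<open>Bernoulli numbers\<close>

text \<open>The divisor has zero constant term and is not a unit. The quotient is exact all the
  same, because both series have subdegree 1.\<close>

lemma bernoulli_fps_mult:
  "fps_X / (fps_exp 1 - 1) * (fps_exp 1 - 1) = (fps_X :: rat fps)"
proof -
  have "subdegree (fps_exp 1 - 1 :: rat fps) = 1"
    by (rule subdegreeI) auto
  then have "fps_exp 1 - 1 dvd (fps_X :: rat fps)"
    by (subst fps_dvd_iff) auto
  then show ?thesis by simp
qed

lemma bernoulli_0 [simp]: "bernoulli 0 = 1"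
proof -
  have "fps_nth (fps_X / (fps_exp 1 - 1) * (fps_exp 1 - 1)) 1 = (1::rat)"
    unfolding bernoulli_fps_mult by simp
  then show ?thesis by (simp add: fps_mult_nth bernoulli_def)
qed

text \<open>The generating function satisfies F(-X) = F(X) + X, so its odd coefficients vanish
  except the one at 1.\<close>

lemma bernoulli_odd_eq_0:
  assumes "odd n" "n \<noteq> 1"
  shows "bernoulli n = 0"
proof -
  define F :: "rat fps" where "F = fps_X / (fps_exp 1 - 1)"
  \<comment> \<open>\<open>G\<close> is F(-X).\<close>
  define G where "G = Abs_fps (\<lambda>n. (-1) ^ n * fps_nth F n)"
  have F: "F * (fps_exp 1 - 1) = fps_X"
    unfolding F_def by (rule bernoulli_fps_mult)
  have "G * (fps_exp (-1) - 1) = - fps_X"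
  proof (rule fps_ext)
    fix n
    have "fps_nth (G * (fps_exp (-1) - 1)) n = (-1) ^ n * fps_nth (F * (fps_exp 1 - 1)) n"
      unfolding fps_mult_nth sum_distrib_left
    proof (rule sum.cong)
      fix i assume "i \<in> {0..n}"
      then have "(-1::rat) ^ n = (-1) ^ i * (-1) ^ (n - i)"
        by (simp flip: power_add)
      then show "fps_nth G i * fps_nth (fps_exp (-1) - 1) (n - i) =
          (-1) ^ n * (fps_nth F i * fps_nth (fps_exp 1 - 1) (n - i))"
        by (simp add: G_def algebra_simps)
    qed simp
    then show "fps_nth (G * (fps_exp (-1) - 1)) n = fps_nth (- fps_X) n"
      by (auto simp: F fps_X_def)
  qed
  moreover have "fps_exp (-1) * fps_exp 1 = (1 :: rat fps)"
    by (simp flip: fps_exp_add_mult)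
  ultimately have "G * (1 - fps_exp 1) = - fps_X * fps_exp 1"
    by (metis left_diff_distrib mult.assoc mult_1)
  then have "(G - F - fps_X) * (fps_exp 1 - 1) = 0"
    using F by (simp add: algebra_simps)
  moreover have "fps_exp 1 - 1 \<noteq> (0 :: rat fps)"
    by (auto simp: fps_eq_iff intro!: exI[of _ 1])
  ultimately have "G - F - fps_X = 0" by simp
  then have "G = F + fps_X" by (simp add: diff_eq_eq add.commute)
  then have "fps_nth G n = fps_nth F n"
    using assms by (simp add: fps_X_def)
  then show ?thesis
    using assms by (simp add: G_def bernoulli_def F_def)
qed

text \<open>Compares coefficients in F (e^(NX) - 1) = X (1 + e^X + ... + e^((N-1)X)). The terms run
  by increasing powers of \<open>N\<close>, so that for N = p the later ones are p-adically
  small.\<close>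

lemma Faulhaber:
  "(\<Sum>i<N. of_nat i ^ n) =
    (\<Sum>j\<le>n. of_nat (n choose j) * bernoulli (n - j) * (of_nat N ^ Suc j / of_nat (Suc j)))"
proof -
  define F :: "rat fps" where "F = fps_X / (fps_exp 1 - 1)"
  define E where "E = (\<Sum>i<N. fps_exp (of_nat i) :: rat fps)"
  have "(fps_exp 1 - 1) * E = fps_exp (of_nat N) - (1 :: rat fps)"
    unfolding E_def
    by (induction N) (simp_all add: algebra_simps fps_exp_add_mult)
  then have "F * (fps_exp (of_nat N) - 1) = F * (fps_exp 1 - 1) * E"
    by (simp add: mult.assoc)
  also have "\<dots> = fps_X * E"
    unfolding F_def bernoulli_fps_mult ..
  finally have "fps_nth (fps_X * E) (Suc n) = fps_nth ((fps_exp (of_nat N) - 1) * F) (Suc n)"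
    by (simp add: mult.commute)
  also have "\<dots> = (\<Sum>j\<le>n. of_nat N ^ Suc j / fact (Suc j) * (bernoulli (n - j) / fact (n - j)))"
    unfolding fps_mult_nth atLeast0AtMost
    by (subst sum.atMost_Suc_shift) (simp add: bernoulli_def F_def algebra_simps)
  finally have "(\<Sum>i<N. of_nat i ^ n / fact n) = \<dots>"
    by (simp add: E_def fps_sum_nth)
  then have "(\<Sum>i<N. of_nat i ^ n) =
      fact n * (\<Sum>j\<le>n. of_nat N ^ Suc j / fact (Suc j) * (bernoulli (n - j) / fact (n - j)))"
    by (simp add: field_simps flip: sum_divide_distrib)
  also have "\<dots> = (\<Sum>j\<le>n. of_nat (n choose j) * bernoulli (n - j) * (of_nat N ^ Suc j / of_nat (Suc j)))"
    unfolding sum_distrib_left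
    by (intro sum.cong) (auto simp: binomial_fact fact_Suc field_simps)
  finally show ?thesis .
qed

text \<open>The arguments 2j up to 2h cancel against the even arguments of the second sum. The
  remaining ones exceed 2h + 1 by exactly the odd numbers below 2h + 1.\<close>

lemma sum_even_minus_sum:
  fixes f :: "nat \<Rightarrow> 'a::comm_ring_1"
  shows "(\<Sum>j = 1..2 * h. f (2 * j)) - (\<Sum>j = 1..2 * h. f j) =
    (\<Sum>j<h. f ((2 * h + 1) + (2 * j + 1)) - f (2 * j + 1))"
proof -
  have split: "(\<Sum>j = 1..h + m. g j) = (\<Sum>j = 1..h. g j) + (\<Sum>j<m. g (h + j + 1))"
    for g :: "nat \<Rightarrow> 'a" and m
    by (induction m) (simp_all add: add.assoc)
  have "(\<Sum>j = 1..2 * h. f j) = (\<Sum>j<h. f (2 * j + 1)) + (\<Sum>j = 1..h. f (2 * j))"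
    by (induction h) (simp_all add: algebra_simps)
  moreover have "(\<Sum>j = 1..2 * h. f (2 * j)) =
      (\<Sum>j = 1..h. f (2 * j)) + (\<Sum>j<h. f ((2 * h + 1) + (2 * j + 1)))"
    unfolding mult_2[of h] split by (simp add: mult_2 ac_simps)
  ultimately show ?thesis by (simp add: sum_subtractf)
qed

section \<open>Powers of the maximal ideal of the local ring of p-integral rationals\<close>

text \<open>The reduced denominator divides every other denominator, so any fraction may serve as a
  witness. Closure under sums and products then needs no cancelling.\<close>

lemma p_integers_iff:
  "x \<in> p_integers p \<longleftrightarrow> (\<exists>a b. x = of_int a / of_int b \<and> \<not> int p dvd b)"
proof -
  obtain c d where cd: "quotient_of x = (c, d)" by (cases "quotient_of x")
  then have d: "d > 0" "coprime c d" "x = of_int c / of_int d"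
    using quotient_of_denom_pos quotient_of_coprime quotient_of_div by blast+
  have "\<not> int p dvd d" if "x = of_int a / of_int b" "\<not> int p dvd b" for a b
  proof
    assume "int p dvd d"
    have "b \<noteq> 0" using that by auto
    then have "(of_int (a * d) :: rat) = of_int (c * b)"
      using that d by (simp add: field_simps)
    then have "a * d = c * b" by (simp only: of_int_eq_iff)
    then have "d dvd c * b" by (metis dvd_triv_right)
    then have "d dvd b"
      using d(2) by (simp add: coprime_commute coprime_dvd_mult_right_iff)
    then show False
      using \<open>int p dvd d\<close> that(2) dvd_trans by blast
  qed
  then show ?thesis
    using cd d by (auto simp: p_integers_def)
qed

locale large_prime =
  fixes p :: nat
  assumes prime: "prime p" and ge_7: "p \<ge> 7"
begin

abbreviation q :: rat where "q \<equiv> of_nat p"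

text \<open>Congruences modulo p^k are handled as memberships of differences, and
  \<open>pideal 0\<close> serves as p-integrality.\<close>

definition pideal :: "nat \<Rightarrow> rat set" where
  "pideal k = {q ^ k * z | z. z \<in> p_integers p}"

lemma padic_cong_iff: "padic_cong p k x y \<longleftrightarrow> x - y \<in> pideal k"
  by (auto simp: padic_cong_def pideal_def)

lemma p_nonzero [simp]: "p \<noteq> 0"
  using ge_7 by simp

lemma p_integers_add:
  assumes "x \<in> p_integers p" "y \<in> p_integers p" shows "x + y \<in> p_integers p"
proof -
  obtain a b c d where x: "x = of_int a / of_int b" "\<not> int p dvd b"
    and y: "y = of_int c / of_int d" "\<not> int p dvd d"
    using assms by (auto simp: p_integers_iff)
  have "b \<noteq> 0" "d \<noteq> 0" using x y by auto
  then have "x + y = of_int (a * d + c * b) / of_int (b * d)"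
    by (simp add: x y field_simps)
  moreover have "\<not> int p dvd b * d"
    using x y prime by (simp add: prime_dvd_mult_iff)
  ultimately show ?thesis unfolding p_integers_iff by blast
qed

lemma p_integers_mult:
  assumes "x \<in> p_integers p" "y \<in> p_integers p" shows "x * y \<in> p_integers p"
proof -
  obtain a b c d where x: "x = of_int a / of_int b" "\<not> int p dvd b"
    and y: "y = of_int c / of_int d" "\<not> int p dvd d"
    using assms by (auto simp: p_integers_iff)
  then have "x * y = of_int (a * c) / of_int (b * d)" by simp
  moreover have "\<not> int p dvd b * d"
    using x y prime by (simp add: prime_dvd_mult_iff)
  ultimately show ?thesis unfolding p_integers_iff by blast
qed

lemma p_integers_of_int: "of_int a \<in> p_integers p"
  unfolding p_integers_iff using ge_7
  by (intro exI[of _ a] exI[of _ 1]) auto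

lemma p_integers_inverse:
  assumes "\<not> p dvd n" shows "1 / of_nat n \<in> p_integers p"
  unfolding p_integers_iff using assms
  by (intro exI[of _ 1] exI[of _ "int n"]) (simp add: int_dvd_int_iff)

lemma pideal_0: "pideal 0 = p_integers p"
  by (simp add: pideal_def)

lemma pideal_add: "x \<in> pideal k \<Longrightarrow> y \<in> pideal k \<Longrightarrow> x + y \<in> pideal k"
  unfolding pideal_def using p_integers_add by (auto simp flip: distrib_left)

lemma pideal_mult: "x \<in> pideal j \<Longrightarrow> y \<in> pideal k \<Longrightarrow> x * y \<in> pideal (j + k)"
proof -
  assume "x \<in> pideal j" "y \<in> pideal k"
  then obtain a b where "x = q ^ j * a" "y = q ^ k * b" "a \<in> p_integers p" "b \<in> p_integers p"
    by (auto simp: pideal_def)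
  then have "x * y = q ^ (j + k) * (a * b)" "a * b \<in> p_integers p"
    by (simp_all add: power_add p_integers_mult)
  then show ?thesis unfolding pideal_def by blast
qed

lemma pideal_of_int [simp]: "of_int a \<in> pideal 0"
  by (simp add: pideal_0 p_integers_of_int)

lemma pideal_of_nat [simp]: "of_nat a \<in> pideal 0"
  using pideal_of_int[of "int a"] by simp

lemma pideal_numeral [simp]: "numeral a \<in> pideal 0" "1 \<in> pideal 0"
  using pideal_of_nat[of "numeral a"] pideal_of_nat[of 1] by simp_all

lemma pideal_q_power: "q ^ k \<in> pideal k"
proof -
  have "q ^ k = q ^ k * 1" "1 \<in> p_integers p"
    using pideal_numeral by (simp_all add: pideal_0)
  then show ?thesis unfolding pideal_def by blast
qed

lemma pideal_zero [simp]: "0 \<in> pideal k"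
  using pideal_mult[OF pideal_q_power pideal_of_int[of 0]] by simp

lemma pideal_mono: "x \<in> pideal k \<Longrightarrow> j \<le> k \<Longrightarrow> x \<in> pideal j"
proof -
  assume "x \<in> pideal k" "j \<le> k"
  then obtain z where "x = q ^ j * (q ^ (k - j) * z)" "z \<in> p_integers p"
    by (auto simp: pideal_def simp flip: power_add mult.assoc)
  moreover have "q ^ (k - j) \<in> p_integers p"
    using p_integers_of_int[of "int p ^ (k - j)"] by simp
  ultimately show ?thesis
    unfolding pideal_def using p_integers_mult by blast
qed

lemma pideal_mult_le: "x \<in> pideal i \<Longrightarrow> y \<in> pideal j \<Longrightarrow> k \<le> i + j \<Longrightarrow> x * y \<in> pideal k"
  by (blast intro: pideal_mult pideal_mono)

lemma pideal_mult_left: "x \<in> pideal 0 \<Longrightarrow> y \<in> pideal k \<Longrightarrow> x * y \<in> pideal k"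
  using pideal_mult[of x 0 y k] by simp

lemma pideal_uminus: "x \<in> pideal k \<Longrightarrow> - x \<in> pideal k"
  using pideal_mult_left[OF pideal_of_int[of "-1"]] by simp

lemma pideal_diff: "x \<in> pideal k \<Longrightarrow> y \<in> pideal k \<Longrightarrow> x - y \<in> pideal k"
  using pideal_add[OF _ pideal_uminus] by simp

lemma pideal_power: "x \<in> pideal 0 \<Longrightarrow> x ^ n \<in> pideal 0"
  by (induction n) (auto intro: pideal_mult_left)

lemma pideal_sum: "(\<And>i. i \<in> A \<Longrightarrow> f i \<in> pideal k) \<Longrightarrow> sum f A \<in> pideal k"
  by (induction A rule: infinite_finite_induct) (auto intro: pideal_add)

lemma pideal_prod: "(\<And>i. i \<in> A \<Longrightarrow> f i \<in> pideal 0) \<Longrightarrow> prod f A \<in> pideal 0"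
  by (induction A rule: infinite_finite_induct) (auto intro: pideal_mult_left)

lemma pideal_inverse: "\<not> p dvd n \<Longrightarrow> 1 / of_nat n \<in> pideal 0"
  by (simp add: pideal_0 p_integers_inverse)

lemma pideal_divide: "x \<in> pideal k \<Longrightarrow> \<not> p dvd n \<Longrightarrow> x / of_nat n \<in> pideal k"
  using pideal_mult_left[OF pideal_inverse] by simp

lemma pideal_cancel: "of_nat n * x \<in> pideal k \<Longrightarrow> \<not> p dvd n \<Longrightarrow> x \<in> pideal k"
  using pideal_divide[of "of_nat n * x" k n] by (cases "n = 0") auto

lemma pideal_q_mult_iff: "q * x \<in> pideal (Suc k) \<longleftrightarrow> x \<in> pideal k"
  by (auto simp: pideal_def mult.assoc)

lemma pideal_divide_q: "x \<in> pideal (Suc k) \<Longrightarrow> x / q \<in> pideal k"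
  using pideal_q_mult_iff[of "x / q" k] by simp

lemma not_dvd_small: "0 < n \<Longrightarrow> n < p \<Longrightarrow> \<not> p dvd n"
  using nat_dvd_not_less by blast

lemma esym_pideal: "(\<And>a. a \<in> A \<Longrightarrow> f a \<in> pideal 0) \<Longrightarrow> esym f A k \<in> pideal 0"
  unfolding esym_def by (intro pideal_sum pideal_prod) auto

lemma pideal_dvd: "int p dvd a \<Longrightarrow> of_int a \<in> pideal 1"
proof -
  assume "int p dvd a"
  then obtain b where "a = int p * b" by blast
  then have "of_int a = q ^ 1 * of_int b" by simp
  then show ?thesis
    by (simp only:) (rule pideal_mult_le[OF pideal_q_power pideal_of_int], simp)
qed

lemma pideal_iff: "x \<in> pideal k \<longleftrightarrow> (\<exists>z\<in>pideal 0. x = q ^ k * z)"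
  by (auto simp: pideal_def)

text \<open>5760 = 2^7 * 3^2 * 5 is the denominator in \<open>esym_upto_4\<close>. It may exceed p,
  so \<open>not_dvd_small\<close> does not apply and the prime factors are checked instead.\<close>

lemma pideal_divide_5760: "x \<in> pideal k \<Longrightarrow> x / 5760 \<in> pideal k"
proof -
  have "\<not> p dvd 5760"
  proof
    assume "p dvd 5760"
    then have "p dvd 2 ^ 7 * (3 ^ 2 * 5)" by simp
    then have "p dvd 2 \<or> p dvd 3 \<or> p dvd 5"
      using prime by (metis prime_dvd_multD prime_dvd_power)
    then show False using ge_7 by (auto dest: dvd_imp_le)
  qed
  moreover assume "x \<in> pideal k"
  ultimately show ?thesis using pideal_divide[of x k 5760] by simp
qed

lemma pideal_divide_2: "x \<in> pideal k \<Longrightarrow> x / 2 \<in> pideal k"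
  using pideal_divide[OF _ not_dvd_small[of 2]] ge_7 by simp

text \<open>As 24 may exceed p, x / 24 is read as 240 x / 5760.\<close>

lemma pideal_divide_24: "x \<in> pideal k \<Longrightarrow> x / 24 \<in> pideal k"
  using pideal_divide_5760[of "of_nat 240 * x" k] pideal_mult_left[OF pideal_of_nat[of 240]] by simp

lemma pideal_mult_right: "x \<in> pideal k \<Longrightarrow> y \<in> pideal 0 \<Longrightarrow> x * y \<in> pideal k"
  using pideal_mult[of x k y 0] by simp

lemma pideal_add_cancel: "x - y \<in> pideal k \<Longrightarrow> y \<in> pideal k \<Longrightarrow> x \<in> pideal k"
  using pideal_add[of "x - y" k y] by simp

lemmas pideal_intros = pideal_add pideal_diff pideal_uminus pideal_mult_left pideal_power
  pideal_of_nat pideal_numeral pideal_zero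

text \<open>The divisibility of the factors themselves, \<open>l\<close> and \<open>m\<close>, adds
  to the precision of the approximations: factors divisible by p and known modulo p^2 have a product
  known modulo p^3.\<close>

lemma pideal_mult_cong:
  assumes "x - x' \<in> pideal j" "y - y' \<in> pideal k" "y \<in> pideal l" "x' \<in> pideal m"
    and "n \<le> j + l" "n \<le> m + k"
  shows "x * y - x' * y' \<in> pideal n"
proof -
  have "x * y - x' * y' = (x - x') * y + x' * (y - y')" by (simp add: algebra_simps)
  then show ?thesis
    using assms by (auto intro!: pideal_add pideal_mult_le)
qed

lemma pideal_power2: "x \<in> pideal 1 \<Longrightarrow> x^2 \<in> pideal 2"
  unfolding power2_eq_square by (rule pideal_mult_le) auto

lemma q_mult: "x \<in> pideal k \<Longrightarrow> q * x \<in> pideal (Suc k)"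
  by (simp add: pideal_q_mult_iff)

lemma even_p1: "even (p - 1)"
  using prime ge_7 prime_odd_nat by simp

section \<open>Power sums modulo powers of p\<close>

text \<open>The denominator costs t powers of p, where t is the multiplicity of p in j + 1. If t >
  0, then t + 4 <= 7^t <= p^t <= j + 1, so at least three powers remain.\<close>

lemma q_power_divide_Suc: "q ^ j / of_nat (Suc j) \<in> pideal (min j 3)"
proof -
  obtain m where m: "Suc j = p ^ multiplicity p (Suc j) * m" "\<not> p dvd m"
    using multiplicity_decompose'[of "Suc j" p] prime by (metis nat.discI not_prime_unit)
  define t where "t = multiplicity p (Suc j)"
  have le: "t + min j 3 \<le> j"
  proof (cases "t = 0")
    case False
    have "t + 4 \<le> 7 ^ t"
      using False by (induction t) (auto, case_tac t, auto)
    also have "\<dots> \<le> p ^ t" using ge_7 by (rule power_mono) simp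
    also have "\<dots> \<le> Suc j" using m by (metis dvd_imp_le dvd_triv_left t_def zero_less_Suc)
    finally show ?thesis by simp
  qed simp
  then have "q ^ j = q ^ t * q ^ (j - t)" by (simp flip: power_add)
  moreover have "(of_nat (Suc j) :: rat) = q ^ t * of_nat m"
    using m(1) unfolding t_def by (metis of_nat_mult of_nat_power)
  ultimately have "q ^ j / of_nat (Suc j) = q ^ (j - t) / of_nat m"
    by (simp del: of_nat_Suc)
  also have "\<dots> \<in> pideal (j - t)"
    using m(2) pideal_q_power by (intro pideal_divide)
  finally show ?thesis
    using le by (rule_tac pideal_mono) auto
qed

definition psum :: "nat \<Rightarrow> rat" where
  "psum n = (\<Sum>i = 1..p-1. of_nat i ^ n)"

text \<open>Grouped into p-integral factors: a Bernoulli number may have p in its denominator, but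
  \<open>q_bernoulli\<close> shows that one factor \<open>q\<close> clears it.\<close>

lemma psum_Faulhaber:
  assumes "n > 0"
  shows "psum n = (\<Sum>j\<le>n. of_nat (n choose j) * (q ^ j / of_nat (Suc j)) * (q * bernoulli (n - j)))"
proof -
  \<comment> \<open>Faulhaber's sum starts at i = 0, a term that vanishes because n > 0.\<close>
  have "{..<p} = insert 0 {1..p-1}" using ge_7 by auto
  then have "psum n = (\<Sum>i<p. of_nat i ^ n)"
    using assms by (simp add: psum_def)
  then show ?thesis by (simp add: Faulhaber mult_ac)
qed

lemma psum_tail:
  assumes "n > 0"
  shows "psum n - q * bernoulli n =
    (\<Sum>j = 1..n. of_nat (n choose j) * (q ^ j / of_nat (Suc j)) * (q * bernoulli (n - j)))"
  unfolding psum_Faulhaber[OF assms] atMost_atLeast0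
  by (subst sum.atLeast_Suc_atMost) auto

lemma psum_pideal_0: "psum n \<in> pideal 0"
  unfolding psum_def by (intro pideal_sum pideal_power pideal_of_nat)

text \<open>The denominator bound contained in the von Staudt-Clausen theorem. Faulhaber's formula
  writes q B_n as an integer minus p-integral multiples of q B_i with i < n.\<close>

lemma q_bernoulli: "q * bernoulli n \<in> pideal 0"
proof (induction n rule: less_induct)
  case (less n)
  show ?case
  proof (cases "n = 0")
    case True then show ?thesis by simp
  next
    case False
    have "psum n - q * bernoulli n \<in> pideal 0"
      unfolding psum_tail[OF False[THEN neq0_conv[THEN iffD1]]]
    proof (rule pideal_sum)
      fix j assume "j \<in> {1..n}"
      then have "q * bernoulli (n - j) \<in> pideal 0" by (intro less) auto
      moreover have "q ^ j / of_nat (Suc j) \<in> pideal 0"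
        using q_power_divide_Suc pideal_mono by blast
      ultimately show "of_nat (n choose j) * (q ^ j / of_nat (Suc j)) * (q * bernoulli (n - j)) \<in> pideal 0"
        using pideal_mult_left pideal_of_nat by blast
    qed
    then have "psum n - (psum n - q * bernoulli n) \<in> pideal 0"
      by (rule pideal_diff[OF psum_pideal_0])
    then show ?thesis by simp
  qed
qed

lemma psum_cong_1:
  assumes "n > 0"
  shows "psum n - q * bernoulli n \<in> pideal 1"
  unfolding psum_tail[OF assms]
proof (rule pideal_sum)
  fix j assume j: "j \<in> {1..n}"
  have "q ^ j / of_nat (Suc j) \<in> pideal 1"
    by (rule pideal_mono[OF q_power_divide_Suc]) (use j in auto)
  then show "of_nat (n choose j) * (q ^ j / of_nat (Suc j)) * (q * bernoulli (n - j)) \<in> pideal 1"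
    by (intro pideal_mult_le[OF pideal_mult_left[OF pideal_of_nat] q_bernoulli]) auto
qed

text \<open>In \<open>psum_tail\<close> the term j = 1 contains a Bernoulli number of odd index at
  least 3, the term j = 2 gains a factor p from the integrality of \<open>bernoulli (n - 2)\<close>,
  and all others carry p^3.\<close>

lemma psum_cong_3:
  assumes "even n" "n \<ge> 4" "bernoulli (n - 2) \<in> pideal 0"
  shows "psum n - q * bernoulli n \<in> pideal 3"
proof -
  have "of_nat (n choose j) * (q ^ j / of_nat (Suc j)) * (q * bernoulli (n - j)) \<in> pideal 3"
    if j: "j \<in> {1..n}" for j
  proof -
    consider "j = 1" | "j = 2" | "j \<ge> 3" using j by force
    then show ?thesis
    proof cases
      case 1
      then have "bernoulli (n - j) = 0" using assms by (intro bernoulli_odd_eq_0) auto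
      then show ?thesis by simp
    next
      case 2
      have "q ^ j / of_nat (Suc j) \<in> pideal 2"
        by (rule pideal_mono[OF q_power_divide_Suc]) (use 2 in auto)
      moreover have "q * bernoulli (n - j) \<in> pideal 1"
        using 2 assms(3) by (simp add: pideal_q_mult_iff)
      ultimately show ?thesis
        by (intro pideal_mult_le[OF pideal_mult_left[OF pideal_of_nat]]) auto
    next
      case 3
      have "q ^ j / of_nat (Suc j) \<in> pideal 3"
        by (rule pideal_mono[OF q_power_divide_Suc]) (use 3 in auto)
      then show ?thesis
        by (intro pideal_mult_le[OF pideal_mult_left[OF pideal_of_nat] q_bernoulli]) auto
    qed
  qed
  then show ?thesis
    using assms by (subst psum_tail) (auto intro!: pideal_sum)
qed

text \<open>Faulhaber's formula with \<open>N = 1\<close> is a recurrence whose denominators j + 1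
  are at most n + 1 < p, hence units.\<close>

lemma bernoulli_pideal: "n \<le> p - 2 \<Longrightarrow> bernoulli n \<in> pideal 0"
proof (induction n rule: less_induct)
  case (less n)
  show ?case
  proof (cases "n = 0")
    case True then show ?thesis by simp
  next
    case False
    have "(0::rat) = (\<Sum>i<1. of_nat i ^ n)" using False by simp
    also have "\<dots> = bernoulli n + (\<Sum>j = 1..n. of_nat (n choose j) * bernoulli (n - j) / of_nat (Suc j))"
      unfolding Faulhaber atMost_atLeast0 by (subst sum.atLeast_Suc_atMost) auto
    finally have "bernoulli n = - (\<Sum>j = 1..n. of_nat (n choose j) * bernoulli (n - j) / of_nat (Suc j))"
      by (simp add: eq_neg_iff_add_eq_0)
    also have "\<dots> \<in> pideal 0"
      using less.prems False ge_7
      by (intro pideal_uminus pideal_sum pideal_divide pideal_mult_left pideal_of_nat less.IH not_dvd_small) auto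
    finally show ?thesis .
  qed
qed

lemma psum_cong_2:
  assumes "n > 0" "n \<le> p - 2"
  shows "psum n - q * bernoulli n \<in> pideal 2"
  unfolding psum_tail[OF assms(1)]
proof (rule pideal_sum)
  fix j assume j: "j \<in> {1..n}"
  have "q ^ j / of_nat (Suc j) \<in> pideal 1"
    by (rule pideal_mono[OF q_power_divide_Suc]) (use j in auto)
  moreover have "q * bernoulli (n - j) \<in> pideal 1"
    using assms bernoulli_pideal[of "n - j"] by (simp add: pideal_q_mult_iff)
  ultimately show "of_nat (n choose j) * (q ^ j / of_nat (Suc j)) * (q * bernoulli (n - j)) \<in> pideal 2"
    by (intro pideal_mult_le[OF pideal_mult_left[OF pideal_of_nat]]) auto
qed

lemma psum_pideal_1:
  assumes "n > 0" "n \<le> p - 2"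
  shows "psum n \<in> pideal 1"
proof -
  have "q * bernoulli n \<in> pideal 1"
    using bernoulli_pideal[OF assms(2)] by (simp add: pideal_q_mult_iff)
  then show ?thesis
    using pideal_add[OF psum_cong_1[OF assms(1)]] by fastforce
qed

section \<open>Fermat quotients (scaled by p) and periodicity of power sums modulo p\<close>

definition fermat_diff :: "nat \<Rightarrow> rat" where
  "fermat_diff r = of_nat r ^ (p - 1) - 1"

lemma fermat_diff_pideal: "\<not> p dvd r \<Longrightarrow> fermat_diff r \<in> pideal 1"
proof -
  assume "\<not> p dvd r"
  then have "[r ^ (p - 1) = 1] (mod p)" using prime fermat_theorem by blast
  then have "[int (r ^ (p - 1)) = int 1] (mod int p)" by (simp only: cong_int_iff)
  then have "int p dvd int r ^ (p - 1) - 1" by (simp add: cong_iff_dvd_diff)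
  then show ?thesis
    using pideal_dvd by (force simp: fermat_diff_def)
qed

lemma psum_periodic: "psum (n + (p - 1)) - psum n \<in> pideal 1"
proof -
  have "psum (n + (p - 1)) - psum n = (\<Sum>i = 1..p-1. of_nat i ^ n * fermat_diff i)"
    by (simp add: psum_def fermat_diff_def power_add algebra_simps sum_subtractf)
  also have "\<dots> \<in> pideal 1"
    using ge_7
    by (intro pideal_sum pideal_mult_left pideal_power pideal_of_nat fermat_diff_pideal not_dvd_small) auto
  finally show ?thesis .
qed

text \<open>By periodicity the power sum with the raised exponent is still divisible by p, hence so
  is q B. This covers the indices near 2p, which \<open>bernoulli_pideal\<close> does not
  reach.\<close>

lemma bernoulli_pideal_shift:
  assumes "n > 0" "n \<le> p - 2"
  shows "bernoulli (n + (p - 1)) \<in> pideal 0"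
proof -
  let ?m = "n + (p - 1)"
  have "q * bernoulli ?m = psum n + (psum ?m - psum n) - (psum ?m - q * bernoulli ?m)" by simp
  also have "\<dots> \<in> pideal 1"
    using assms by (intro pideal_add pideal_diff psum_pideal_1 psum_periodic psum_cong_1) auto
  finally show ?thesis by (simp add: pideal_q_mult_iff)
qed

section \<open>Wilson quotient and Newton identities\<close>

abbreviation w :: rat where "w \<equiv> wilson_quotient p"

lemma fact_wilson: "fact (p - 1) = q * w - 1"
  by (simp add: wilson_quotient_def)

lemma wilson_pideal: "w \<in> pideal 0"
proof -
  have "[fact (p - 1) = - 1] (mod int p)"
    using wilson_theorem prime by simp
  then have "int p dvd fact (p - 1) + 1" by (simp add: cong_iff_dvd_diff)
  then have "of_int (fact (p - 1) + 1) \<in> pideal 1" by (rule pideal_dvd)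
  moreover have "q * w = of_int (fact (p - 1) + 1)" by (simp add: wilson_quotient_def)
  ultimately have "q * w \<in> pideal (Suc 0)" by (simp only: One_nat_def)
  then show ?thesis by (simp only: pideal_q_mult_iff)
qed

lemma A_sum_esym: "A_sum p = esym of_nat {1..p-1}"
  by (simp add: A_sum_def esym_def fun_eq_iff)

lemma A_star_esym: "A_star p = esym (\<lambda>i. 1 / of_nat i) {1..p-1}"
  unfolding A_star_def esym_def fun_eq_iff by (simp add: prod_dividef)

lemma A_star_A_sum:
  assumes "k \<le> p - 1"
  shows "A_star p k * (q * w - 1) = A_sum p (p - 1 - k)"
proof -
  have "(\<Prod>i = 1..p-1. of_nat i) = q * w - 1"
    by (simp flip: fact_wilson add: fact_prod)
  then show ?thesis
    using esym_inverse[of "{1..p-1}" "of_nat :: nat \<Rightarrow> rat" k] assms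
    by (simp add: A_sum_esym A_star_esym)
qed

lemma unit_pideal: "i \<in> {1..p-1} \<Longrightarrow> 1 / of_nat i \<in> pideal 0"
  by (intro pideal_inverse not_dvd_small) auto

lemma A_star_pideal: "A_star p k \<in> pideal 0"
  unfolding A_star_esym by (intro esym_pideal unit_pideal)

lemma A_sum_pideal: "A_sum p k \<in> pideal 0"
  unfolding A_sum_esym by (intro esym_pideal pideal_of_nat)

text \<open>With y = q w, \<open>A_star_A_sum\<close> says that A_star = - A_sum / (1 - y). The
  geometric series is cut after y^3, and the exact remainder is a p-integral multiple of
  p^4.\<close>

lemma A_star_expansion:
  assumes "k \<le> p - 1"
  shows "A_star p k = - (1 + q * w + (q * w)^2 + (q * w)^3) * A_sum p (p - 1 - k)
    + q ^ 4 * (w ^ 4 * A_star p k)"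
proof -
  have "a = - (1 + y + y^2 + y^3) * (a * (y - 1)) + y^4 * a" for a y :: rat
    by (simp add: algebra_simps eval_nat_numeral)
  from this[of "A_star p k" "q * w"] show ?thesis
    by (simp add: A_star_A_sum[OF assms] power_mult_distrib)
qed

lemma A_sum_Newton:
  "of_nat m * A_sum p m = (\<Sum>i = 1..m. A_sum p (m - i) * ((-1) ^ (i - 1) * psum i))"
proof (cases m)
  case (Suc n)
  have "(\<Sum>i = 1..Suc n. A_sum p (Suc n - i) * ((-1) ^ (i - 1) * psum i)) =
      (\<Sum>i\<le>n. A_sum p (n - i) * ((-1) ^ i * psum (Suc i)))"
    by (simp only: One_nat_def sum.atLeast1_atMost_eq lessThan_Suc_atMost diff_Suc_Suc diff_Suc_1 diff_zero)
  then show ?thesis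
    using esym_Newton[of "{1..p-1}" n "of_nat :: nat \<Rightarrow> rat"]
    by (simp only: Suc A_sum_esym psum_def finite_atLeastAtMost)
qed simp

lemma divided_bernoulli_pideal:
  assumes "0 < n" "n \<le> p - 2"
  shows "divided_bernoulli n \<in> pideal 0"
  unfolding divided_bernoulli_def
  using assms by (intro pideal_divide bernoulli_pideal not_dvd_small) auto

lemma A_sum_pideal_1:
  assumes "0 < j" "j \<le> p - 2"
  shows "A_sum p j \<in> pideal 1"
proof -
  have "of_nat j * A_sum p j \<in> pideal 1"
    unfolding A_sum_Newton
    using assms
    by (intro pideal_sum pideal_mult_left A_sum_pideal psum_pideal_1 pideal_power pideal_uminus) auto
  then show ?thesis
    using assms by (rule_tac pideal_cancel[OF _ not_dvd_small]) auto
qed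

text \<open>In Newton's identity every product with i < j has two factors divisible by p, so only
  the power sum of exponent j survives modulo p^2.\<close>

lemma A_sum_cong_2:
  assumes "0 < j" "j \<le> p - 2"
  shows "A_sum p j + (-1) ^ j * q * divided_bernoulli j \<in> pideal 2"
proof -
  obtain n where n: "j = Suc n" using assms(1) by (cases j) auto
  have *: "A_sum p (j - i) * ((-1) ^ (i - 1) * psum i) \<in> pideal 2" if "i \<in> {1..n}" for i
  proof -
    have "(-1) ^ (i - 1) * psum i \<in> pideal 1"
      using that assms n by (intro pideal_mult_left pideal_power pideal_uminus psum_pideal_1) auto
    then show ?thesis
      using that assms n by (intro pideal_mult_le[OF A_sum_pideal_1]) auto
  qed
  have "of_nat j * (A_sum p j + (-1) ^ j * q * divided_bernoulli j) =
      of_nat j * A_sum p j + (-1) ^ j * q * bernoulli j"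
    using assms by (simp add: divided_bernoulli_def distrib_left)
  also have "of_nat j * A_sum p j =
      (\<Sum>i = 1..n. A_sum p (j - i) * ((-1) ^ (i - 1) * psum i)) + (-1) ^ n * psum j"
    unfolding A_sum_Newton n by (simp add: A_sum_esym)
  also have "\<dots> + (-1) ^ j * q * bernoulli j =
      (\<Sum>i = 1..n. A_sum p (j - i) * ((-1) ^ (i - 1) * psum i)) + (-1) ^ n * (psum j - q * bernoulli j)"
    by (simp add: n algebra_simps)
  also have "\<dots> \<in> pideal 2"
    using assms by (intro pideal_add pideal_sum * pideal_mult_left pideal_power pideal_uminus psum_cong_2) auto
  finally show ?thesis
    using assms by (rule_tac pideal_cancel[OF _ not_dvd_small]) auto
qed

text \<open>The terms i = 1 and i = m - 1 vanish because B_(m-1) = 0. On the rest, the reflection of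
  i to m - i replaces the weight i by its average m / 2.\<close>

lemma sum_bernoulli_convolution:
  assumes "even m" "m \<ge> 4"
  shows "(\<Sum>i = 1..m-1. divided_bernoulli (m - i) * bernoulli i) =
    of_nat m / 2 * bernoulli_convolution m"
proof -
  let ?d = divided_bernoulli
  have "bernoulli (m - 1) = 0" using assms by (intro bernoulli_odd_eq_0) auto
  moreover have "{1..m-1} = insert 1 (insert (m - 1) {2..m-2})" using assms by auto
  moreover have "m - 1 \<notin> {2..m-2}" "1 \<notin> insert (m - 1) {2..m-2}" using assms by auto
  ultimately have "(\<Sum>i = 1..m-1. ?d (m - i) * bernoulli i) = (\<Sum>i = 2..m-2. ?d (m - i) * bernoulli i)"
    using assms by (simp add: divided_bernoulli_def del: One_nat_def)
  also have "\<dots> = (\<Sum>i = 2..m-2. of_nat i * (?d i * ?d (m - i)))"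
    by (intro sum.cong) (auto simp: divided_bernoulli_def)
  finally have 1: "(\<Sum>i = 1..m-1. ?d (m - i) * bernoulli i) = \<dots>" .
  have "(\<Sum>i = 2..m-2. of_nat i * (?d i * ?d (m - i))) = (\<Sum>i = 2..m-2. of_nat (m - i) * (?d i * ?d (m - i)))"
    by (rule sum.reindex_bij_witness[of _ "\<lambda>i. m - i" "\<lambda>i. m - i"]) auto
  then have "2 * (\<Sum>i = 2..m-2. of_nat i * (?d i * ?d (m - i))) =
      (\<Sum>i = 2..m-2. of_nat i * (?d i * ?d (m - i)) + of_nat (m - i) * (?d i * ?d (m - i)))"
    by (simp add: sum.distrib)
  also have "\<dots> = (\<Sum>i = 2..m-2. of_nat m * (?d i * ?d (m - i)))"
    by (intro sum.cong) (auto simp: of_nat_diff left_diff_distrib)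
  finally show ?thesis
    unfolding 1 bernoulli_convolution_def by (simp flip: sum_distrib_left)
qed

text \<open>The products with i < m in Newton's identity are now kept. Both factors are divisible by
  p and known modulo p^2, so each product is known modulo p^3, and together they form the
  convolution.\<close>

lemma A_sum_cong_3:
  assumes "even m" "4 \<le> m" "m \<le> p - 3"
  shows "A_sum p m + q * divided_bernoulli m - q^2 / 2 * bernoulli_convolution m \<in> pideal 3"
proof -
  let ?d = divided_bernoulli
  obtain n where n: "m = Suc n" using assms(2) by (cases m) auto
  have *: "A_sum p (m - i) * ((-1) ^ (i - 1) * psum i) - q^2 * (?d (m - i) * bernoulli i) \<in> pideal 3"
    if i: "i \<in> {1..n}" for i
  proof -
    \<comment> \<open>As m is even, the signs of the two factors combine to -1 for every i.\<close>
    have "(-1::rat) ^ (m - i) * (-1) ^ (i - 1) = (-1) ^ n"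
      using i n by (simp flip: power_add)
    then have "(-1::rat) ^ (m - i) * (-1) ^ (i - 1) = -1"
      using assms n by simp
    moreover have "x - q^2 * (d * b) = x - (- (s * q * d)) * (t * (q * b))"
      if "s * t = -1" for x s t d b
    proof -
      have "(- (s * q * d)) * (t * (q * b)) = - (s * t) * (q^2 * (d * b))"
        by (simp add: power2_eq_square)
      then show ?thesis using that by simp
    qed
    ultimately have "A_sum p (m - i) * ((-1) ^ (i - 1) * psum i) - q^2 * (?d (m - i) * bernoulli i) =
        A_sum p (m - i) * ((-1) ^ (i - 1) * psum i) -
        (- ((-1) ^ (m - i) * q * ?d (m - i))) * ((-1) ^ (i - 1) * (q * bernoulli i))"
      by blast
    also have "\<dots> \<in> pideal 3"
    proof (rule pideal_mult_cong[where j = 2 and k = 2 and l = 1 and m = 1])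
      show "A_sum p (m - i) - - ((-1) ^ (m - i) * q * ?d (m - i)) \<in> pideal 2"
        using A_sum_cong_2[of "m - i"] i n assms by simp
      have "(-1) ^ (i - 1) * (psum i - q * bernoulli i) \<in> pideal 2"
        using i n assms by (intro pideal_mult_left pideal_power pideal_uminus psum_cong_2) auto
      then show "(-1) ^ (i - 1) * psum i - (-1) ^ (i - 1) * (q * bernoulli i) \<in> pideal 2"
        by (simp add: right_diff_distrib)
      show "(-1) ^ (i - 1) * psum i \<in> pideal 1"
        using i n assms by (intro pideal_mult_left pideal_power pideal_uminus psum_pideal_1) auto
      have "(-1) ^ (m - i) * ?d (m - i) \<in> pideal 0"
        using i n assms by (intro pideal_mult_left pideal_power pideal_uminus divided_bernoulli_pideal) auto
      then have "q * ((-1) ^ (m - i) * ?d (m - i)) \<in> pideal 1"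
        by (simp add: pideal_q_mult_iff)
      then show "- ((-1) ^ (m - i) * q * ?d (m - i)) \<in> pideal 1"
        by (simp add: pideal_uminus mult_ac)
    qed auto
    finally show ?thesis .
  qed
  have "of_nat m * (A_sum p m + q * ?d m - q^2 / 2 * bernoulli_convolution m) =
      of_nat m * A_sum p m + q * bernoulli m - q^2 * (of_nat m / 2 * bernoulli_convolution m)"
    using assms by (simp add: divided_bernoulli_def field_simps)
  also have "of_nat m * A_sum p m =
      (\<Sum>i = 1..n. A_sum p (m - i) * ((-1) ^ (i - 1) * psum i)) - psum m"
    unfolding A_sum_Newton using n assms(1) by (simp add: A_sum_esym)
  also have "of_nat m / 2 * bernoulli_convolution m = (\<Sum>i = 1..n. ?d (m - i) * bernoulli i)"
    using sum_bernoulli_convolution[OF assms(1,2)] n by simp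
  also have "(\<Sum>i = 1..n. A_sum p (m - i) * ((-1) ^ (i - 1) * psum i)) - psum m + q * bernoulli m -
        q^2 * (\<Sum>i = 1..n. ?d (m - i) * bernoulli i) =
      (\<Sum>i = 1..n. A_sum p (m - i) * ((-1) ^ (i - 1) * psum i) - q^2 * (?d (m - i) * bernoulli i)) -
        (psum m - q * bernoulli m)"
    by (simp add: sum_subtractf sum_distrib_left)
  also have "\<dots> \<in> pideal 3"
    using assms
    by (intro pideal_diff pideal_sum[OF *] psum_cong_3 bernoulli_pideal) auto
  finally show ?thesis
    using assms by (rule_tac pideal_cancel[OF _ not_dvd_small]) auto
qed

lemma bernoulli_convolution_pideal: "m \<le> p \<Longrightarrow> bernoulli_convolution m \<in> pideal 0"
  unfolding bernoulli_convolution_def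
  by (intro pideal_sum pideal_mult_left divided_bernoulli_pideal) auto

text \<open>The leading term \<open>- A_sum\<close> stays as it is. In all other terms of
  \<open>A_star_expansion\<close> the symmetric sum is multiplied by q w, so its value modulo p^3
  suffices.\<close>

lemma A_star_cong_generic:
  assumes "4 \<le> 2 * n" "2 * n \<le> p - 7"
  shows "padic_cong p 4 (A_star p (2 * n))
    (- A_sum p (p - 1 - 2 * n)
     + q^2 * w * (1 + q * w) * divided_bernoulli (p - 1 - 2 * n)
     - q^3 * w / 2 * bernoulli_convolution (p - 1 - 2 * n))"
proof -
  define m where "m = p - 1 - 2 * n"
  define d where "d = divided_bernoulli m"
  define C where "C = bernoulli_convolution m / 2"
  define a where "a = A_star p (2 * n)"
  have "odd p" using prime ge_7 prime_odd_nat by simp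
  then have m: "even m" "4 \<le> m" "m \<le> p - 3" using assms by (auto simp: m_def)
  have mem: "d \<in> pideal 0" "C \<in> pideal 0" "a \<in> pideal 0"
    using m by (auto simp: d_def C_def a_def intro!: divided_bernoulli_pideal pideal_divide_2
        bernoulli_convolution_pideal A_star_pideal)
  obtain z where z: "z \<in> pideal 0"
    "A_sum p m + q * d - q^2 * C = q ^ 3 * z"
    using A_sum_cong_3[OF m] unfolding pideal_iff[of _ 3] d_def C_def by auto
  have A: "A_sum p m = - q * d + q^2 * C + q ^ 3 * z" using z(2) by (simp add: algebra_simps)
  have "a = - (1 + q * w + (q * w)^2 + (q * w)^3) * A_sum p m + q ^ 4 * (w ^ 4 * a)"
    using A_star_expansion[of "2 * n"] assms unfolding a_def m_def by simp
  then have "a - (- A_sum p m + q^2 * w * (1 + q * w) * d - q^3 * w * C) =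
      q ^ 4 * (w^4 * a - w * z - w^2 * (C + q * z) - w^3 * (- d + q * C + q^2 * z))"
    unfolding A by (simp add: algebra_simps eval_nat_numeral)
  also have "\<dots> \<in> pideal 4"
    by (intro pideal_mult_right pideal_q_power pideal_intros mem wilson_pideal z)
  finally show ?thesis
    by (simp add: padic_cong_iff a_def C_def d_def m_def)
qed

section \<open>Fermat quotients against the Wilson quotient\<close>

text \<open>Products of three or more of the f i lie in \<open>pideal 3\<close>. The quadratic term
  is the second elementary symmetric sum, written through power sums.\<close>

lemma prod_one_plus_cong:
  assumes "finite A" "\<And>i. i \<in> A \<Longrightarrow> f i \<in> pideal 1"
  shows "(\<Prod>i\<in>A. 1 + f i) - (1 + sum f A + ((sum f A)^2 - (\<Sum>i\<in>A. (f i)^2)) / 2) \<in> pideal 3"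
  using assms
proof (induction A rule: finite_induct)
  case (insert a A)
  define s t where "s = sum f A" and "t = (\<Sum>i\<in>A. (f i)^2)"
  define z where "z = (\<Prod>i\<in>A. 1 + f i) - (1 + s + (s^2 - t) / 2)"
  have z: "z \<in> pideal 3" using insert by (simp add: z_def s_def t_def)
  have f: "f i \<in> pideal 1" if "i \<in> insert a A" for i using insert that by simp
  have s: "s \<in> pideal 1" unfolding s_def by (intro pideal_sum f) auto
  have t: "t \<in> pideal 2"
    unfolding t_def power2_eq_square by (intro pideal_sum pideal_mult_le[OF f f]) auto
  have "s^2 \<in> pideal 2" unfolding power2_eq_square by (rule pideal_mult_le[OF s s]) simp
  then have st: "(s^2 - t) / 2 \<in> pideal 2" using t by (intro pideal_divide_2 pideal_diff)
  have "(\<Prod>i\<in>insert a A. 1 + f i) = (1 + f a) * (1 + s + (s^2 - t) / 2 + z)"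
    "sum f (insert a A) = f a + s" "(\<Sum>i\<in>insert a A. (f i)^2) = (f a)^2 + t"
    using insert(1,2) by (simp_all add: z_def s_def t_def)
  then have "(\<Prod>i\<in>insert a A. 1 + f i) -
      (1 + sum f (insert a A) + ((sum f (insert a A))^2 - (\<Sum>i\<in>insert a A. (f i)^2)) / 2) =
      f a * ((s^2 - t) / 2) + (1 + f a) * z"
    by (simp only:) (simp add: field_simps power2_eq_square)
  also have "\<dots> \<in> pideal 3"
    by (intro pideal_add pideal_mult_le[OF f st] pideal_mult_left z pideal_numeral pideal_mono[OF f]) auto
  finally show ?case .
qed simp

lemma power_one_plus_cong:
  assumes "x \<in> pideal 1"
  shows "(1 + x) ^ n - (1 + of_nat n * x + of_nat n * (of_nat n - 1) / 2 * x^2) \<in> pideal 3"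
proof -
  have "(1 + x) ^ n - (1 + of_nat n * x + of_nat n * (of_nat n - 1) / 2 * x^2) =
      (\<Prod>i<n. 1 + x) - (1 + (\<Sum>i<n. x) + ((\<Sum>i<n. x)^2 - (\<Sum>i<n. x^2)) / 2)"
    by (simp add: field_simps power2_eq_square)
  then show ?thesis
    using prod_one_plus_cong[of "{..<n}" "\<lambda>_. x"] assms by simp
qed

definition fermat_sum :: rat where "fermat_sum = (\<Sum>i = 1..p-1. fermat_diff i)"
definition fermat_sum2 :: rat where "fermat_sum2 = (\<Sum>i = 1..p-1. (fermat_diff i)^2)"

lemma fermat_diff_pideal': "i \<in> {1..p-1} \<Longrightarrow> fermat_diff i \<in> pideal 1"
  by (intro fermat_diff_pideal not_dvd_small) auto

lemma fermat_sum_pideal: "fermat_sum \<in> pideal 1"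
  unfolding fermat_sum_def by (intro pideal_sum fermat_diff_pideal')

lemma fermat_sum2_pideal: "fermat_sum2 \<in> pideal 2"
  unfolding fermat_sum2_def power2_eq_square
  by (intro pideal_sum pideal_mult_le[OF fermat_diff_pideal' fermat_diff_pideal']) auto

lemma psum_fermat: "psum (p - 1) = q - 1 + fermat_sum"
  using ge_7 by (simp add: psum_def fermat_sum_def fermat_diff_def sum_subtractf of_nat_diff)

lemma psum_fermat2: "psum (2 * (p - 1)) = q - 1 + 2 * fermat_sum + fermat_sum2"
proof -
  have "of_nat i ^ (2 * (p - 1)) = 1 + 2 * fermat_diff i + (fermat_diff i)^2" for i
    unfolding fermat_diff_def mult.commute[of 2] power_mult by (simp add: field_simps power2_eq_square)
  then show ?thesis
    using ge_7 by (simp add: psum_def fermat_sum_def fermat_sum2_def sum.distrib sum_distrib_left of_nat_diff)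
qed

lemma qw_pideal: "q * w \<in> pideal 1"
  using wilson_pideal by (simp add: pideal_q_mult_iff)

text \<open>Two evaluations of ((p - 1)!)^(p - 1): as the product of all 1 +
  \<open>fermat_diff i\<close>, and as the binomial expansion of (1 - q w)^(p - 1), where the sign
  disappears because p - 1 is even.\<close>

lemma wilson_fermat_3:
  "q * w - q * (q * w) + (q * w)^2 - (fermat_sum + (fermat_sum^2 - fermat_sum2) / 2) \<in> pideal 3"
proof -
  define y where "y = q * w"
  have y: "y \<in> pideal 1" using qw_pideal by (simp add: y_def)
  have "(\<Prod>i = 1..p-1. 1 + fermat_diff i) = (fact (p - 1)) ^ (p - 1)"
    by (simp add: fermat_diff_def fact_prod prod_power_distrib)
  also have "\<dots> = (1 + - y) ^ (p - 1)"
    unfolding fact_wilson y_def using even_p1 by (metis minus_diff_eq diff_conv_add_uminus power_minus_even)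
  finally have prod: "(\<Prod>i = 1..p-1. 1 + fermat_diff i) = \<dots>" .
  have 1: "(1 + - y) ^ (p - 1) - (1 + fermat_sum + (fermat_sum^2 - fermat_sum2) / 2) \<in> pideal 3"
    using prod_one_plus_cong[of "{1..p-1}" fermat_diff] fermat_diff_pideal'
    unfolding prod fermat_sum_def fermat_sum2_def by blast
  have 2: "(1 + - y) ^ (p - 1) - (1 - (q - 1) * y + (q - 1) * (q - 2) / 2 * y^2) \<in> pideal 3"
    using power_one_plus_cong[OF pideal_uminus[OF y], of "p - 1"] ge_7 by (simp add: of_nat_diff)
  \<comment> \<open>This is the excess of the binomial term (q - 1) (q - 2) / 2 * y^2 over
    y^2.\<close>
  have "q * ((q - 3) / 2 * y^2) \<in> pideal (Suc 2)"
    by (intro q_mult pideal_mult_left[OF _ pideal_power2[OF y]] pideal_divide_2 pideal_intros)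
  then have 3: "q * ((q - 3) / 2 * y^2) \<in> pideal 3"
    by (simp only: Suc_numeral) simp
  have "((1 + - y) ^ (p - 1) - (1 + fermat_sum + (fermat_sum^2 - fermat_sum2) / 2)) -
      ((1 + - y) ^ (p - 1) - (1 - (q - 1) * y + (q - 1) * (q - 2) / 2 * y^2)) -
      q * ((q - 3) / 2 * y^2) \<in> pideal 3"
    by (intro pideal_diff[OF pideal_diff[OF 1 2] 3])
  also have "((1 + - y) ^ (p - 1) - (1 + fermat_sum + (fermat_sum^2 - fermat_sum2) / 2)) -
      ((1 + - y) ^ (p - 1) - (1 - (q - 1) * y + (q - 1) * (q - 2) / 2 * y^2)) -
      q * ((q - 3) / 2 * y^2) = y - q * y + y^2 - (fermat_sum + (fermat_sum^2 - fermat_sum2) / 2)"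
    by (simp add: field_simps power2_eq_square)
  finally show ?thesis by (simp only: y_def)
qed

lemma wilson_fermat_2: "q * w - fermat_sum \<in> pideal 2"
proof -
  have "q * w - fermat_sum =
      (q * w - q * (q * w) + (q * w)^2 - (fermat_sum + (fermat_sum^2 - fermat_sum2) / 2)) +
      q * (q * w) - (q * w)^2 + (fermat_sum^2 - fermat_sum2) / 2" by simp
  also have "\<dots> \<in> pideal 2"
    using q_mult[OF qw_pideal]
    by (intro pideal_add pideal_diff pideal_divide_2 pideal_mono[OF wilson_fermat_3] pideal_power2
        qw_pideal fermat_sum_pideal fermat_sum2_pideal) (simp_all add: eval_nat_numeral)
  finally show ?thesis .
qed

text \<open>\<open>psum (p - 1)\<close> is q - 1 + \<open>fermat_sum\<close>, close to q B_(p-1),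
  and \<open>fermat_sum\<close> is q w modulo p^2. Thus 1 + w may replace the Agoh-Giuga quotient
  wherever p^3 multiplies it.\<close>

lemma agoh_giuga_cong: "agoh_giuga_quotient p - (1 + w) \<in> pideal 1"
proof -
  have "psum (p - 1) - q * bernoulli (p - 1) \<in> pideal 3"
    using ge_7 even_p1 by (intro psum_cong_3 bernoulli_pideal) auto
  then have "(fermat_sum - q * w) - (psum (p - 1) - q * bernoulli (p - 1)) \<in> pideal 2"
    using pideal_diff[OF pideal_uminus[OF wilson_fermat_2] pideal_mono[of _ 3 2]] by simp
  also have "(fermat_sum - q * w) - (psum (p - 1) - q * bernoulli (p - 1)) =
      q * (agoh_giuga_quotient p - (1 + w))"
    unfolding psum_fermat agoh_giuga_quotient_def by (simp add: field_simps)
  finally show ?thesis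
    using pideal_q_mult_iff[of "agoh_giuga_quotient p - (1 + w)" 1] by (simp add: eval_nat_numeral)
qed

section \<open>The indices p - 5, p - 3 and p - 1\<close>

lemma A_star_cong_p_minus_5:
  assumes "p \<ge> 11"
  shows "padic_cong p 4 (A_star p (p - 5))
    (1/8 * (5 * q^3 / 4 - q / 15 - q^2 / 36)
     + q * w / 120 * (7 * q^2 / 12 - q * (1 + q * agoh_giuga_quotient p)))"
proof -
  define a where "a = A_star p (p - 5)"
  \<comment> \<open>\<open>Z\<close> gathers the part of 5760 * \<open>A_sum p 4\<close> that is
    divisible by q^4; the lower coefficients are 48, 20 and -900.\<close>
  define Z where "Z = 2015 - 1848 * q + 830 * q^2 - 180 * q^3 + 15 * q^4"
  obtain e where e: "e \<in> pideal 0" "agoh_giuga_quotient p = 1 + w + q * e"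
    using agoh_giuga_cong unfolding pideal_iff[of _ 1] by (auto simp: algebra_simps)
  have A: "A_sum p 4 = (q - 4) * (q - 3) * (q - 2) * (q - 1) * q *
      (15 * (q - 1) ^ 3 + 15 * (q - 1)^2 - 10 * (q - 1) - 8) / 5760"
    unfolding A_sum_esym esym_upto_4 using ge_7 by (simp add: of_nat_diff)
  have a: "a = - (1 + q * w + (q * w)^2 + (q * w)^3) * A_sum p 4 + q ^ 4 * (w ^ 4 * a)"
    using A_star_expansion[of "p - 5"] assms unfolding a_def by simp
  have A': "A_sum p 4 = q * (48 + 20 * q - 900 * q^2 + q^3 * Z) / 5760"
    unfolding A Z_def by (simp add: algebra_simps eval_nat_numeral)
  \<comment> \<open>With 1 + w + q e in place of the Agoh-Giuga quotient, all terms below q^4 cancel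
    identically.\<close>
  have "- (1 + q * w + (q * w)^2 + (q * w)^3) * (q * (48 + 20 * q - 900 * q^2 + q^3 * Z) / 5760)
      + q ^ 4 * (w ^ 4 * a) - (1/8 * (5 * q^3 / 4 - q / 15 - q^2 / 36)
     + q * w / 120 * (7 * q^2 / 12 - q * (1 + q * agoh_giuga_quotient p))) =
    q ^ 4 * (w ^ 4 * a + (48 * (w * e) - Z - w * (- 900 + q * Z) - w^2 * (20 - 900 * q + q^2 * Z)
      - w^3 * (48 + 20 * q - 900 * q^2 + q^3 * Z)) / 5760)"
    unfolding e(2) by (simp add: field_simps eval_nat_numeral)
  then have "a - (1/8 * (5 * q^3 / 4 - q / 15 - q^2 / 36)
     + q * w / 120 * (7 * q^2 / 12 - q * (1 + q * agoh_giuga_quotient p))) = \<dots>"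
    by (simp only: A'[symmetric] a[symmetric])
  also have "\<dots> \<in> pideal 4"
    unfolding Z_def a_def
    by (intro pideal_mult_right[OF pideal_q_power] pideal_intros pideal_divide_5760 e
        A_star_pideal wilson_pideal)
  finally show ?thesis by (simp only: padic_cong_iff a_def)
qed

text \<open>Runs as for the index p - 5, with the complementary sum \<open>A_sum p 2\<close> and its
  exact polynomial.\<close>

lemma A_star_cong_p_minus_3:
  "padic_cong p 4 (A_star p (p - 3))
    (1/24 * (q * (2 * q - 1) * (5 * q - 2)
      + q * w * (2 * q - 11 * q^2 + 2 * q^2 * agoh_giuga_quotient p)))"
proof -
  define a where "a = A_star p (p - 3)"
  obtain e where e: "e \<in> pideal 0" "agoh_giuga_quotient p = 1 + w + q * e"
    using agoh_giuga_cong unfolding pideal_iff[of _ 1] by (auto simp: algebra_simps)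
  have "A_sum p 2 = (q - 2) * (q - 1) * q * (3 * (q - 1) + 2) / 24"
    unfolding A_sum_esym esym_upto_2 using ge_7 by (simp add: of_nat_diff)
  then have A: "A_sum p 2 = q * (- 2 + 9 * q - 10 * q^2 + 3 * q^3) / 24"
    by (simp add: algebra_simps eval_nat_numeral)
  have a: "a = - (1 + q * w + (q * w)^2 + (q * w)^3) * A_sum p 2 + q ^ 4 * (w ^ 4 * a)"
    using A_star_expansion[of "p - 3"] ge_7 unfolding a_def by simp
  have "- (1 + q * w + (q * w)^2 + (q * w)^3) * (q * (- 2 + 9 * q - 10 * q^2 + 3 * q^3) / 24)
      + q ^ 4 * (w ^ 4 * a) - (1/24 * (q * (2 * q - 1) * (5 * q - 2)
      + q * w * (2 * q - 11 * q^2 + 2 * q^2 * agoh_giuga_quotient p))) =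
    q ^ 4 * (w ^ 4 * a + (- 3 + w * (10 - 3 * q) - 2 * w * e + w^2 * (- 9 + 10 * q - 3 * q^2)
      + w^3 * (2 - 9 * q + 10 * q^2 - 3 * q^3)) / 24)"
    unfolding e(2) by (simp add: field_simps eval_nat_numeral)
  then have "a - (1/24 * (q * (2 * q - 1) * (5 * q - 2)
      + q * w * (2 * q - 11 * q^2 + 2 * q^2 * agoh_giuga_quotient p))) = \<dots>"
    by (simp only: A[symmetric] a[symmetric])
  also have "\<dots> \<in> pideal 4"
    unfolding a_def
    by (intro pideal_mult_right[OF pideal_q_power] pideal_intros pideal_divide_24 e
        A_star_pideal wilson_pideal)
  finally show ?thesis by (simp only: padic_cong_iff a_def)
qed

text \<open>The complementary sum is 1, so the value is -(1 + y + y^2 + y^3) modulo p^4 with y = q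
  w. It remains to match 1 + y + y^2 with a Bernoulli expression modulo p^3, since the common factor
  y supplies the fourth power.\<close>

lemma A_star_cong_p_minus_1:
  "padic_cong p 4 (A_star p (p - 1))
    (-1 + q * w * (3 * (q * divided_bernoulli (p - 1) - 1)
      - q * divided_bernoulli (2 * (p - 1)) - 1/2 * q^2 * (divided_bernoulli (p - 1))^2))"
proof -
  define y a b b' s t u where "y = q * w" and "a = A_star p (p - 1)"
    and "b = q * divided_bernoulli (p - 1)" and "b' = q * divided_bernoulli (2 * (p - 1))"
    and "s = fermat_sum" and "t = fermat_sum2" and "u = 1 / (q - 1)"
  have p1: "of_nat (p - 1) = q - 1" "q - 1 \<noteq> 0"
    using ge_7 by (simp_all add: of_nat_diff)
  have u: "u \<in> pideal 0" "(q - 1) * u = 1"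
    using pideal_inverse[OF not_dvd_small[of "p - 1"]] ge_7 p1 by (auto simp: u_def)
  have "bernoulli (2 * (p - 1) - 2) = bernoulli ((p - 3) + (p - 1))"
    using ge_7 by (intro arg_cong[of _ _ bernoulli]) auto
  then have "bernoulli (2 * (p - 1) - 2) \<in> pideal 0"
    using bernoulli_pideal_shift[of "p - 3"] ge_7 by simp
  then have "psum (2 * (p - 1)) - q * bernoulli (2 * (p - 1)) \<in> pideal 3"
    using ge_7 by (intro psum_cong_3) auto
  then obtain z' where z': "z' \<in> pideal 0" "q - 1 + 2 * s + t - q * bernoulli (2 * (p - 1)) = q ^ 3 * z'"
    unfolding psum_fermat2 pideal_iff[of _ 3] s_def t_def by blast
  have "psum (p - 1) - q * bernoulli (p - 1) \<in> pideal 3"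
    using ge_7 even_p1 by (intro psum_cong_3 bernoulli_pideal) auto
  then obtain z where z: "z \<in> pideal 0" "q - 1 + s - q * bernoulli (p - 1) = q ^ 3 * z"
    unfolding psum_fermat pideal_iff[of _ 3] s_def t_def by blast
  have b: "b = 1 + u * s - q ^ 3 * (u * z)"
  proof -
    have "b = u * (q * bernoulli (p - 1))"
      by (simp add: b_def divided_bernoulli_def p1(1) u_def del: One_nat_def)
    also have "q * bernoulli (p - 1) = q - 1 + s - q ^ 3 * z" using z(2) by simp
    also have "u * (q - 1 + s - q ^ 3 * z) = (q - 1) * u + u * s - q ^ 3 * (u * z)"
      by (simp add: algebra_simps)
    finally show ?thesis by (simp only: u(2))
  qed
  have b': "b' = 1/2 + u * s + u * t / 2 - q ^ 3 * (u * z' / 2)"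
  proof -
    have "of_nat (2 * (p - 1)) = 2 * (q - 1)"
      by (simp only: of_nat_mult p1 of_nat_numeral)
    then have "b' = u * (q * bernoulli (2 * (p - 1))) / 2"
      by (simp only: b'_def divided_bernoulli_def u_def) (simp add: field_simps)
    also have "q * bernoulli (2 * (p - 1)) = q - 1 + 2 * s + t - q ^ 3 * z'" using z'(2) by simp
    also have "u * (q - 1 + 2 * s + t - q ^ 3 * z') / 2 =
        (q - 1) * u / 2 + u * s + u * t / 2 - q ^ 3 * (u * z' / 2)"
      by (simp add: field_simps)
    finally show ?thesis by (simp only: u(2))
  qed
  obtain s1 where s: "s1 \<in> pideal 0" "s = q * s1"
    using fermat_sum_pideal unfolding pideal_iff[of _ 1] s_def by auto
  obtain t1 where t: "t1 \<in> pideal 0" "t = q^2 * t1"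
    using fermat_sum2_pideal unfolding pideal_iff[of _ 2] t_def by auto
  obtain e where e: "e \<in> pideal 0" "y = s + q^2 * e"
    using wilson_fermat_2 unfolding pideal_iff[of _ 2] y_def s_def by (auto simp: algebra_simps)
  obtain f where f: "f \<in> pideal 0" "y - q * y + y^2 - (s + (s^2 - t) / 2) = q ^ 3 * f"
    using wilson_fermat_3 unfolding pideal_iff[of _ 3] y_def s_def t_def by auto
  \<comment> \<open>Two terms of the p-adic expansion of 1 / (q - 1), with exact remainder.\<close>
  have ue: "u = -1 - q + q^2 * u"
  proof -
    have "(q - 1) * (-1 - q + q^2 * u) = 1 - q^2 + q^2 * ((q - 1) * u)"
      by (simp add: algebra_simps power2_eq_square)
    then have "(q - 1) * (-1 - q + q^2 * u) = (q - 1) * u" by (simp add: u(2))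
    then show ?thesis using p1(2) by simp
  qed
  \<comment> \<open>Minus the bracket that multiplies \<open>q * w\<close> in the claim.\<close>
  define E where "E = 3 - 3 * b + b' + b^2 / 2"
  have "1 + y + y^2 - E \<in> pideal 3"
  proof -
    have "1 + y + y^2 = 1 + q * y + s + (s^2 - t) / 2 + q ^ 3 * f"
      using f(2) by (simp add: algebra_simps)
    also have "q * y = q * s + q ^ 3 * e"
      by (simp add: e(2) algebra_simps eval_nat_numeral)
    finally have 1: "1 + y + y^2 = 1 + q * s + s + (s^2 - t) / 2 + q ^ 3 * (e + f)"
      by (simp add: algebra_simps)
    \<comment> \<open>The cruder form u = -1 + q v is enough for u t and (u s)^2, because t and s^2
      already lie in \<open>pideal 2\<close>.\<close>
    define v where "v = - 1 + q * u"
    have uv: "u = -1 + q * v" using ue by (simp add: v_def algebra_simps power2_eq_square)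
    have "E = 1 - u * s + u * t / 2 + (u * s)^2 / 2 +
        q ^ 3 * (2 * u * z - u * z' / 2 - u * s * (u * z) + q ^ 3 * (u * z)^2 / 2)"
      unfolding E_def b b' by (simp add: field_simps eval_nat_numeral)
    moreover have "u * s = - s - q * s + q ^ 3 * (u * s1)"
      by (subst ue) (simp add: s(2) algebra_simps eval_nat_numeral)
    moreover have "u * t = - t + q ^ 3 * (v * t1)"
      by (subst uv) (simp add: t(2) algebra_simps eval_nat_numeral)
    moreover have "(u * s)^2 = s^2 + q ^ 3 * (s1^2 * (v * (q * v - 2)))"
      by (subst uv) (simp add: s(2) algebra_simps eval_nat_numeral)
    ultimately have 2: "E = 1 + s + q * s - t / 2 + s^2 / 2 + q ^ 3 *
        (2 * u * z - u * z' / 2 - u * s * (u * z) + q ^ 3 * (u * z)^2 / 2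
          - u * s1 + v * t1 / 2 + s1^2 * (v * (q * v - 2)) / 2)"
      by (simp add: algebra_simps add_divide_distrib diff_divide_distrib)
    have "1 + y + y^2 - E = q ^ 3 * (e + f -
        (2 * u * z - u * z' / 2 - u * s * (u * z) + q ^ 3 * (u * z)^2 / 2
          - u * s1 + v * t1 / 2 + s1^2 * (v * (q * v - 2)) / 2))"
      unfolding 1 2 by (simp add: algebra_simps diff_divide_distrib)
    also have "\<dots> \<in> pideal 3"
      unfolding s(2) v_def
      by (intro pideal_mult_right[OF pideal_q_power] pideal_intros pideal_divide_2 u z z' e f s t)
    finally show ?thesis .
  qed
  then have "y * (1 + y + y^2 - E) \<in> pideal 4"
    using qw_pideal by (intro pideal_mult_le[of _ 1 _ 3]) (auto simp: y_def)
  then have "q ^ 4 * (w ^ 4 * a) - y * (1 + y + y^2 - E) \<in> pideal 4"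
    unfolding a_def
    by (rule pideal_diff[rotated]) (intro pideal_mult_right[OF pideal_q_power] pideal_intros A_star_pideal wilson_pideal)
  moreover have "a = - (1 + y + y^2 + y ^ 3) + q ^ 4 * (w ^ 4 * a)"
    using A_star_expansion[of "p - 1"] unfolding a_def y_def by (simp add: A_sum_esym)
  then have "a - (-1 + y * (3 * (b - 1) - b' - 1/2 * b^2)) = q ^ 4 * (w ^ 4 * a) - y * (1 + y + y^2 - E)"
    unfolding E_def by (simp add: algebra_simps eval_nat_numeral)
  ultimately show ?thesis
    unfolding padic_cong_iff a_def y_def b_def b'_def by (simp add: power_mult_distrib mult.assoc)
qed

section \<open>A second-order Kummer congruence\<close>

text \<open>
  \<open>kpow t r\<close> is \<open>r\<close> to the power \<open>kexp t\<close>, so the exponents for \<open>t = 0, 1, 2\<close> are \<open>-2\<close>,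
  \<open>p - 3\<close> and \<open>2 p - 4\<close>.
\<close>

definition kpow :: "nat \<Rightarrow> nat \<Rightarrow> rat" where
  "kpow t r = (1 + fermat_diff r) ^ t / of_nat r ^ 2"

definition kexp :: "nat \<Rightarrow> rat" where "kexp t = of_nat t * (q - 1) - 2"

definition ksum :: "nat \<Rightarrow> rat" where "ksum t = (\<Sum>r = 1..p-1. kpow t r)"

lemma kpow_mult: "kpow t (a * b) = kpow t a * kpow t b"
  by (simp add: kpow_def fermat_diff_def power_mult_distrib)

lemma inverse_pideal: "\<not> p dvd r \<Longrightarrow> 1 / of_nat r ^ k \<in> pideal 0"
  using pideal_power[OF pideal_inverse[of r], of k] by (simp add: power_divide)

lemma kpow_pideal: "\<not> p dvd r \<Longrightarrow> kpow t r \<in> pideal 0"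
proof -
  assume r: "\<not> p dvd r"
  have "(1 + fermat_diff r) ^ t * (1 / of_nat r ^ 2) \<in> pideal 0"
    unfolding fermat_diff_def
    by (intro pideal_intros inverse_pideal r)
  then show ?thesis by (simp add: kpow_def)
qed

text \<open>Second-order expansion of the k-th power at r, with k = \<open>kexp t\<close> negative
  for t = 0. The natural number N = k + 2 admits the finite binomial expansion, and the surplus (1 +
  v)^2 is removed by its p-integral inverse \<open>u^2\<close>.\<close>

lemma kpow_shift:
  assumes r: "\<not> p dvd r"
  shows "kpow t (p + r) - kpow t r -
    kpow t r * (q * kexp t / of_nat r + q^2 * (kexp t * (kexp t - 1)) / (2 * of_nat r ^ 2)) \<in> pideal 3"
proof -
  define N where "N = (p - 1) * t"
  define v where "v = q / of_nat r"
  define k where "k = kexp t"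
  have N: "of_nat N = k + 2"
    using ge_7 by (simp add: N_def k_def kexp_def of_nat_diff)
  have r0: "of_nat r \<noteq> (0 :: rat)" using r by (metis dvd_0_right of_nat_eq_0_iff)
  have pr: "\<not> p dvd p + r" using r by simp
  then have pr0: "of_nat (p + r) \<noteq> (0 :: rat)" by (metis dvd_0_right of_nat_eq_0_iff)
  have v: "v \<in> pideal 1"
    using q_mult[OF pideal_inverse[OF r]] by (simp add: v_def)
  define u :: rat where "u = of_nat r / of_nat (p + r)"
  have u: "u \<in> pideal 0"
    unfolding u_def using pr by (intro pideal_divide pideal_of_nat)
  have prv: "of_nat (p + r) = of_nat r * (1 + v)"
    using r0 by (simp add: v_def field_simps)
  have "u * (1 + v) = of_nat r * (1 + v) / of_nat (p + r)" by (simp add: u_def)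
  also have "\<dots> = 1" unfolding prv[symmetric] using pr0 by (rule divide_self)
  finally have uv: "u * (1 + v) = 1" .
  define z where "z = (1 + v) ^ N - (1 + of_nat N * v + of_nat N * (of_nat N - 1) / 2 * v^2)"
  have z: "z \<in> pideal 3" unfolding z_def by (rule power_one_plus_cong[OF v])
  have "kpow t (p + r) = (of_nat r * (1 + v)) ^ N / (of_nat r * (1 + v)) ^ 2"
    unfolding kpow_def fermat_diff_def N_def by (simp only: prv power_mult) simp
  also have "\<dots> = kpow t r * ((1 + v) ^ N * u ^ 2)"
  proof -
    have "u = 1 / (1 + v)" using uv by (metis mult_zero_right eq_divide_eq zero_neq_one)
    then show ?thesis
      unfolding kpow_def fermat_diff_def N_def by (simp add: power_mult power_mult_distrib power_divide)
  qed
  also have "(1 + v) ^ N = z + (1 + of_nat N * v + of_nat N * (of_nat N - 1) / 2 * v^2)"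
    by (simp add: z_def)
  \<comment> \<open>The quadratic binomial polynomial for k + 2 is the one for k times (1 + v)^2, up
    to multiples of v^3.\<close>
  also have "\<dots> = (1 + k * v + k * (k - 1) / 2 * v^2) * (1 + v)^2 +
      (z - v ^ 3 * (k + k * (k - 1) + k * (k - 1) / 2 * v))"
    unfolding N by (simp add: field_simps eval_nat_numeral)
  also have "\<dots> * u^2 = (1 + k * v + k * (k - 1) / 2 * v^2) * (u * (1 + v))^2 +
      u^2 * (z - v ^ 3 * (k + k * (k - 1) + k * (k - 1) / 2 * v))"
    unfolding power_mult_distrib by (simp only: distrib_right distrib_left mult_ac)
  also have "kpow t r * \<dots> - kpow t r - kpow t r * (q * k / of_nat r + q^2 * (k * (k - 1)) / (2 * of_nat r ^ 2))
     = kpow t r * (u^2 * (z - v ^ 3 * (k + k * (k - 1) + k * (k - 1) / 2 * v)))"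
    unfolding uv by (simp add: v_def power_divide algebra_simps)
  also have "\<dots> \<in> pideal 3"
  proof -
    have k: "k \<in> pideal 0" unfolding k_def kexp_def by (intro pideal_intros)
    have "v * v \<in> pideal 2" by (rule pideal_mult_le[OF v v]) simp
    then have "v * (v * v) \<in> pideal 3" by (rule pideal_mult_le[OF v]) simp
    then have "v ^ 3 \<in> pideal 3" by (simp add: eval_nat_numeral)
    then show ?thesis
      by (intro pideal_mult_left[OF kpow_pideal[OF r]] pideal_mult_left[OF pideal_power[OF u]]
          pideal_diff z pideal_mult_right pideal_intros pideal_divide_2 k pideal_mono[OF v]) auto
  qed
  finally show ?thesis by (simp only: k_def)
qed

lemma ksum_1: "ksum 1 = psum (p - 3)" and ksum_2: "ksum 2 = psum (2 * p - 4)"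
proof -
  have "kpow 1 r = of_nat r ^ (p - 3)" "kpow 2 r = of_nat r ^ (2 * p - 4)" if "r \<in> {1..p-1}" for r
  proof -
    have "p - 1 = 2 + (p - 3)" "(p - 1) * 2 = 2 + (2 * p - 4)" using ge_7 by auto
    then have "(of_nat r :: rat) ^ (p - 1) = of_nat r ^ 2 * of_nat r ^ (p - 3)"
      "((of_nat r :: rat) ^ (p - 1)) ^ 2 = of_nat r ^ 2 * of_nat r ^ (2 * p - 4)"
      by (metis power_add, metis power_add power_mult)
    then show "kpow 1 r = of_nat r ^ (p - 3)" "kpow 2 r = of_nat r ^ (2 * p - 4)"
      using that by (auto simp: kpow_def fermat_diff_def)
  qed
  then show "ksum 1 = psum (p - 3)" "ksum 2 = psum (2 * p - 4)"
    by (auto simp: ksum_def psum_def intro!: sum.cong)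
qed

lemma psum_ksum_pideal:
  shows "psum (p - 3) \<in> pideal 1" and "psum (2 * p - 4) \<in> pideal 1" and "ksum 0 \<in> pideal 1"
proof -
  show 1: "psum (p - 3) \<in> pideal 1" using ge_7 by (intro psum_pideal_1) auto
  have "p - 3 + (p - 1) = 2 * p - 4" using ge_7 by auto
  then have "psum (2 * p - 4) - psum (p - 3) \<in> pideal 1"
    using psum_periodic[of "p - 3"] by simp
  then show "psum (2 * p - 4) \<in> pideal 1" using 1 by (rule pideal_add_cancel)
  have "ksum 1 - ksum 0 = (\<Sum>r = 1..p-1. 1 / of_nat r ^ 2 * fermat_diff r)"
    unfolding ksum_def by (simp add: kpow_def field_simps flip: sum_subtractf)
  also have "\<dots> \<in> pideal 1"
    by (intro pideal_sum pideal_mult_left fermat_diff_pideal' inverse_pideal not_dvd_small) auto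
  finally show "ksum 0 \<in> pideal 1"
    using pideal_diff[OF 1[folded ksum_1]] by fastforce
qed

lemma kexp_unit: "t \<le> 2 \<Longrightarrow> 1 / kexp t \<in> pideal 0 \<and> kexp t \<noteq> 0"
proof -
  assume "t \<le> 2"
  then consider "t = 0" | "t = 1" | "t = 2" by linarith
  then show ?thesis
  proof cases
    case 1
    then show ?thesis using pideal_uminus[OF pideal_divide_2, of 1 0] by (simp add: kexp_def)
  next
    case 2
    then have "kexp t = of_nat (p - 3)" using ge_7 by (simp add: kexp_def of_nat_diff)
    then show ?thesis using ge_7 pideal_inverse[OF not_dvd_small[of "p - 3"]] by auto
  next
    case 3
    then have "kexp t = 2 * of_nat (p - 2)" using ge_7 by (simp add: kexp_def of_nat_diff)
    then show ?thesis
      using ge_7 pideal_divide_2[OF pideal_inverse[OF not_dvd_small[of "p - 2"]]] by (auto simp: mult.commute)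
  qed
qed

text \<open>Approximates B_k / k for the exponents k = p - 3 and k = 2 p - 4, and continues this
  quotient to k = -2.\<close>

definition kquot :: "nat \<Rightarrow> rat" where "kquot t = ksum t / (q * kexp t)"

lemma kquot_pideal: "t \<le> 2 \<Longrightarrow> kquot t \<in> pideal 0"
proof -
  assume t: "t \<le> 2"
  then consider "t = 0" | "t = 1" | "t = 2" by linarith
  then have "ksum t \<in> pideal (Suc 0)"
    by cases (use psum_ksum_pideal ksum_1 ksum_2 in simp_all)
  then have "ksum t / q * (1 / kexp t) \<in> pideal 0"
    using kexp_unit[OF t] by (intro pideal_mult_right pideal_divide_q) auto
  then show ?thesis by (simp add: kquot_def)
qed

text \<open>The increment in \<open>kpow_shift\<close>, divided by
  \<open>q * kexp t\<close>.\<close>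

definition kodd :: "nat \<Rightarrow> nat \<Rightarrow> rat" where
  "kodd t r = kpow t r * (1 / of_nat r + q * (kexp t - 1) / (2 * of_nat r ^ 2))"

text \<open>The doubling identity \<open>sum_even_minus_sum\<close>, with every difference expanded
  by \<open>kpow_shift\<close>. One power of p is lost on dividing by q.\<close>

lemma kquot_kodd:
  assumes t: "t \<le> 2"
  shows "(kpow t 2 - 1) * kquot t - (\<Sum>j<(p - 1) div 2. kodd t (2 * j + 1)) \<in> pideal 2"
proof -
  define h where "h = (p - 1) div 2"
  have ph: "p = 2 * h + 1" "p - 1 = 2 * h" using even_p1 ge_7 by (auto simp: h_def)
  have "(kpow t 2 - 1) * ksum t = (\<Sum>j = 1..2*h. kpow t (2 * j)) - (\<Sum>j = 1..2*h. kpow t j)"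
    unfolding ksum_def ph(2) by (simp add: kpow_mult left_diff_distrib flip: sum_distrib_left)
  also have "\<dots> = (\<Sum>j<h. kpow t (p + (2 * j + 1)) - kpow t (2 * j + 1))"
    unfolding sum_even_minus_sum ph(1) ..
  finally have "(kpow t 2 - 1) * ksum t - (\<Sum>j<h. q * (kexp t * kodd t (2 * j + 1))) =
      (\<Sum>j<h. kpow t (p + (2 * j + 1)) - kpow t (2 * j + 1) - q * (kexp t * kodd t (2 * j + 1)))"
    by (simp add: sum_subtractf)
  also have "\<dots> \<in> pideal 3"
  proof (rule pideal_sum)
    fix j assume "j \<in> {..<h}"
    then have "\<not> p dvd 2 * j + 1" using ph by (intro not_dvd_small) auto
    from kpow_shift[OF this, of t]
    show "kpow t (p + (2 * j + 1)) - kpow t (2 * j + 1) - q * (kexp t * kodd t (2 * j + 1)) \<in> pideal 3"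
      by (simp add: kodd_def algebra_simps power2_eq_square)
  qed
  finally have "1 / kexp t * (((kpow t 2 - 1) * ksum t - (\<Sum>j<h. q * (kexp t * kodd t (2 * j + 1)))) / q)
      \<in> pideal 2"
    using kexp_unit[OF t] by (intro pideal_mult_left pideal_divide_q) (auto simp: eval_nat_numeral)
  also have "1 / kexp t * (((kpow t 2 - 1) * ksum t - (\<Sum>j<h. q * (kexp t * kodd t (2 * j + 1)))) / q) =
      (kpow t 2 - 1) * kquot t - (\<Sum>j<h. kodd t (2 * j + 1))"
    using kexp_unit[OF t]
    by (simp add: kquot_def diff_divide_distrib right_diff_distrib flip: sum_distrib_left)
  finally show ?thesis by (simp only: h_def)
qed

text \<open>The dependence on t is through (1 + x)^t, with x in \<open>pideal 1\<close>, and through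
  \<open>kexp t\<close>, which is linear in t and multiplied by q. Hence each difference in t gains
  a factor p.\<close>

lemma kodd_differences:
  assumes r: "\<not> p dvd r"
  shows "kodd 0 r - 2 * kodd 1 r + kodd 2 r \<in> pideal 2"
    and "kodd 2 r - kodd 1 r \<in> pideal 1"
proof -
  define x where "x = fermat_diff r"
  define i where "i k = 1 / (of_nat r :: rat) ^ k" for k
  have x: "x \<in> pideal 1" unfolding x_def by (rule fermat_diff_pideal[OF r])
  have i: "i k \<in> pideal 0" for k unfolding i_def by (rule inverse_pideal[OF r])
  have kodd: "kodd t r = (1 + x) ^ t * (i 3 + q * (kexp t - 1) / 2 * i 4)" for t
    by (simp add: kodd_def kpow_def i_def x_def algebra_simps eval_nat_numeral)
  have "kodd 0 r - 2 * kodd 1 r + kodd 2 r = x^2 * i 3 + (q * x) * ((2 * q - 2 + (2 * q - 5) * x) / 2 * i 4)"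
    unfolding kodd kexp_def by (simp add: field_simps eval_nat_numeral)
  also have "\<dots> \<in> pideal 2"
  proof (rule pideal_add)
    show "x^2 * i 3 \<in> pideal 2" by (intro pideal_mult_right pideal_power2 x i)
    have "q * x \<in> pideal 2" using q_mult[OF x] by (simp add: eval_nat_numeral)
    then show "(q * x) * ((2 * q - 2 + (2 * q - 5) * x) / 2 * i 4) \<in> pideal 2"
      by (rule pideal_mult_right) (intro pideal_intros pideal_divide_2 i pideal_mono[OF x], auto)
  qed
  finally show "kodd 0 r - 2 * kodd 1 r + kodd 2 r \<in> pideal 2" .
  have "kodd 2 r - kodd 1 r = x * ((1 + x) * i 3) +
      q * (((1 + x)^2 * (2 * q - 5) - (1 + x) * (q - 4)) / 2 * i 4)"
    unfolding kodd kexp_def by (simp add: field_simps eval_nat_numeral)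
  also have "\<dots> \<in> pideal 1"
  proof (rule pideal_add)
    show "x * ((1 + x) * i 3) \<in> pideal 1"
      by (rule pideal_mult_right[OF x]) (intro pideal_intros i pideal_mono[OF x], auto)
    have "q * (((1 + x)^2 * (2 * q - 5) - (1 + x) * (q - 4)) / 2 * i 4) \<in> pideal (Suc 0)"
      by (rule q_mult) (intro pideal_intros pideal_divide_2 i pideal_mono[OF x], auto)
    then show "q * (((1 + x)^2 * (2 * q - 5) - (1 + x) * (q - 4)) / 2 * i 4) \<in> pideal 1" by simp
  qed
  finally show "kodd 2 r - kodd 1 r \<in> pideal 1" .
qed

text \<open>The factor \<open>D t\<close> is the unit -3/4 up to a multiple of x. Differencing
  \<open>D t * G t\<close> twice leaves the cross term x (G 2 - G 1) / 2, so the first difference of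
  G is treated beforehand.\<close>

lemma kquot_second_difference: "kquot 0 - 2 * kquot 1 + kquot 2 \<in> pideal 2"
proof -
  define h where "h = (p - 1) div 2"
  define V where "V t = (\<Sum>j<h. kodd t (2 * j + 1))" for t
  define D where "D t = kpow t 2 - 1" for t
  define x where "x = fermat_diff 2"
  define G where "G = kquot"
  have x: "x \<in> pideal 1"
    unfolding x_def by (intro fermat_diff_pideal not_dvd_small) (use ge_7 in auto)
  have DV: "D t * G t - V t \<in> pideal 2" if "t \<le> 2" for t
    using kquot_kodd[OF that] by (simp add: D_def V_def G_def h_def)
  have odd: "\<not> p dvd 2 * j + 1" if "j < h" for j
    using that by (intro not_dvd_small) (auto simp: h_def)
  have V2: "V 0 - 2 * V 1 + V 2 \<in> pideal 2"
  proof -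
    have "V 0 - 2 * V 1 + V 2 = (\<Sum>j<h. kodd 0 (2*j+1) - 2 * kodd 1 (2*j+1) + kodd 2 (2*j+1))"
      by (simp add: V_def sum.distrib sum_subtractf sum_distrib_left)
    then show ?thesis using kodd_differences(1)[OF odd] by (auto intro: pideal_sum)
  qed
  have V1: "V 2 - V 1 \<in> pideal 1"
    unfolding V_def sum_subtractf[symmetric] using kodd_differences(2)[OF odd] by (auto intro: pideal_sum)
  have D: "D t = (1 + x) ^ t / 4 - 1" for t by (simp add: D_def kpow_def x_def)
  have G: "G 0 \<in> pideal 0" "G 1 \<in> pideal 0" "G 2 \<in> pideal 0"
    by (simp_all add: G_def kquot_pideal)
  have four: "y / 4 \<in> pideal k" if "y \<in> pideal k" for y k
    using pideal_divide_2[OF pideal_divide_2[OF that]] by simp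
  have cancel: "y \<in> pideal k" if "- 3 / 4 * y \<in> pideal k" for y k
  proof (rule pideal_cancel[of 3])
    show "of_nat 3 * y \<in> pideal k"
      using pideal_mult_left[OF pideal_uminus[OF pideal_of_nat[of 4]] that] by simp
    show "\<not> p dvd 3" using ge_7 by (intro not_dvd_small) auto
  qed
  have G21: "G 2 - G 1 \<in> pideal 1"
  proof (rule cancel)
    have "(D 2 * G 2 - V 2) - (D 1 * G 1 - V 1) + (V 2 - V 1) - x * (((2 + x) * G 2 - G 1) / 4) \<in> pideal 1"
      by (intro pideal_add pideal_diff pideal_mono[OF DV] V1 pideal_mult_right[OF x] four pideal_mult_left
        G pideal_numeral pideal_mono[OF x]) auto
    also have "(D 2 * G 2 - V 2) - (D 1 * G 1 - V 1) + (V 2 - V 1) - x * (((2 + x) * G 2 - G 1) / 4) =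
        - 3 / 4 * (G 2 - G 1)"
      unfolding D by (simp add: field_simps power2_eq_square)
    finally show "- 3 / 4 * (G 2 - G 1) \<in> pideal 1" .
  qed
  have "- 3 / 4 * (G 0 - 2 * G 1 + G 2) =
      (D 0 * G 0 - V 0) - 2 * (D 1 * G 1 - V 1) + (D 2 * G 2 - V 2) + (V 0 - 2 * V 1 + V 2)
      - x * (G 2 - G 1) / 2 - x^2 * G 2 / 4"
    unfolding D by (simp add: field_simps power2_eq_square)
  also have "\<dots> \<in> pideal 2"
    by (intro pideal_add pideal_diff DV pideal_mult_left[OF pideal_numeral(1)] V2 pideal_divide_2
        four pideal_mult_le[OF x G21] pideal_mult_right[OF pideal_power2[OF x]] G) auto
  finally show ?thesis unfolding G_def by (rule cancel)
qed

text \<open>The second difference is solved for \<open>kquot 0\<close>, where \<open>kexp 0\<close>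
  = -2 gives the factor -2, and the other two quotients are replaced by divided Bernoulli
  numbers.\<close>

lemma ksum_0_cong:
  "ksum 0 + 2 * q * (2 * divided_bernoulli (p - 3) - divided_bernoulli (2 * p - 4)) \<in> pideal 3"
proof -
  have e: "2 * p - 4 - 2 = p - 5 + (p - 1)" using ge_7 by auto
  have 1: "psum (p - 3) - q * bernoulli (p - 3) \<in> pideal 3"
    using ge_7 even_p1 by (intro psum_cong_3 bernoulli_pideal) auto
  have 2: "psum (2 * p - 4) - q * bernoulli (2 * p - 4) \<in> pideal 3"
  proof (rule psum_cong_3)
    show "bernoulli (2 * p - 4 - 2) \<in> pideal 0"
      unfolding e using ge_7 by (intro bernoulli_pideal_shift) auto
  qed (use ge_7 in auto)
  have k: "kexp 0 = -2" "kexp 1 = of_nat (p - 3)" "kexp 2 = of_nat (2 * p - 4)"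
    using ge_7 by (simp_all add: kexp_def of_nat_diff algebra_simps)
  have eq: "q * (psum n / (q * y)) - q * (bernoulli n / y) = 1 / y * (psum n - q * bernoulli n)" for n y
    by (cases "y = 0") (simp_all add: field_simps)
  have a: "q * kquot 1 - q * divided_bernoulli (p - 3) \<in> pideal 3"
    unfolding kquot_def ksum_1 divided_bernoulli_def k eq
    by (rule pideal_mult_left[OF conjunct1[OF kexp_unit[of 1, unfolded k]] 1]) simp
  have b: "q * kquot 2 - q * divided_bernoulli (2 * p - 4) \<in> pideal 3"
    unfolding kquot_def ksum_2 divided_bernoulli_def k eq
    by (rule pideal_mult_left[OF conjunct1[OF kexp_unit[of 2, unfolded k]] 2]) simp
  have c: "q * (kquot 0 - 2 * kquot 1 + kquot 2) \<in> pideal 3"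
    using q_mult[OF kquot_second_difference] by (simp add: eval_nat_numeral)
  have "- 2 * (q * (kquot 0 - 2 * kquot 1 + kquot 2)
      + 2 * (q * kquot 1 - q * divided_bernoulli (p - 3))
      - (q * kquot 2 - q * divided_bernoulli (2 * p - 4))) \<in> pideal 3"
    by (rule pideal_mult_left[OF _ pideal_diff[OF pideal_add[OF c
            pideal_mult_left[OF pideal_numeral(1) a]] b]]) (use pideal_of_int[of "-2"] in simp)
  also have "- 2 * (q * (kquot 0 - 2 * kquot 1 + kquot 2)
      + 2 * (q * kquot 1 - q * divided_bernoulli (p - 3))
      - (q * kquot 2 - q * divided_bernoulli (2 * p - 4))) =
      ksum 0 + 2 * q * (2 * divided_bernoulli (p - 3) - divided_bernoulli (2 * p - 4))"
  proof -
    have "ksum 0 = - 2 * (q * kquot 0)" by (simp add: kquot_def k)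
    then show ?thesis by (simp add: algebra_simps)
  qed
  finally show ?thesis .
qed

text \<open>Wolstenholme's theorem: the complementary index p - 2 is odd, so the Bernoulli number in
  \<open>A_sum_cong_2\<close> vanishes.\<close>

lemma A_star_1_pideal: "A_star p 1 \<in> pideal 2"
proof -
  have "odd (p - 2)" using even_p1 ge_7 by simp
  then have "A_sum p (p - 2) \<in> pideal 2"
    using A_sum_cong_2[of "p - 2"] bernoulli_odd_eq_0[of "p - 2"] ge_7
    by (simp add: divided_bernoulli_def)
  moreover have "p - 1 - 1 = p - 2" by simp
  ultimately have "- (1 + q * w + (q * w)^2 + (q * w)^3) * A_sum p (p - 1 - 1) \<in> pideal 2"
    by (simp only:) (intro pideal_mult_left pideal_intros wilson_pideal)
  moreover have "q ^ 4 * (w ^ 4 * A_star p 1) \<in> pideal 4"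
    by (intro pideal_mult_right[OF pideal_q_power] pideal_intros wilson_pideal A_star_pideal)
  then have "q ^ 4 * (w ^ 4 * A_star p 1) \<in> pideal 2" by (rule pideal_mono) simp
  ultimately have "- (1 + q * w + (q * w)^2 + (q * w)^3) * A_sum p (p - 1 - 1)
      + q ^ 4 * (w ^ 4 * A_star p 1) \<in> pideal 2"
    by (rule pideal_add)
  then show ?thesis
    using A_star_expansion[of 1] ge_7 by (simp only:)
qed

text \<open>The sum of \<open>A_star p 2\<close> and \<open>A_sum p (p - 3)\<close> is exactly q w
  times \<open>A_star p 2\<close>, which is therefore needed modulo p^3 only. There Newton's
  identity reduces it to -1/2 times \<open>ksum 0\<close>, as the square of
  \<open>A_star p 1\<close> lies in \<open>pideal 4\<close>.\<close>

lemma A_star_cong_2: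
  "padic_cong p 4 (A_star p 2)
    (- A_sum p (p - 3)
      + q^2 * w * (2 * divided_bernoulli (p - 3) - divided_bernoulli (2 * p - 4)))"
proof -
  define b where "b = 2 * divided_bernoulli (p - 3) - divided_bernoulli (2 * p - 4)"
  let ?f = "\<lambda>i. 1 / (of_nat i :: rat)"
  have "A_star p 1 = (\<Sum>i = 1..p-1. ?f i)"
    using esym_Newton[of "{1..p-1}" 0 ?f] by (simp add: A_star_esym)
  moreover have "ksum 0 = (\<Sum>i = 1..p-1. ?f i ^ 2)"
    by (simp add: ksum_def kpow_def power_divide)
  ultimately have "2 * A_star p 2 = A_star p 1 * A_star p 1 - ksum 0"
    using esym_Newton[of "{1..p-1}" 1 ?f] by (simp add: A_star_esym eval_nat_numeral)
  then have "A_star p 2 - q * b = (A_star p 1 * A_star p 1 - (ksum 0 + 2 * q * b)) / 2"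
    by (simp add: field_simps)
  also have "\<dots> \<in> pideal 3"
    unfolding b_def
    by (intro pideal_divide_2 pideal_diff ksum_0_cong pideal_mult_le[OF A_star_1_pideal A_star_1_pideal]) auto
  finally have "q * w * (A_star p 2 - q * b) \<in> pideal 4"
    by (intro pideal_mult_le[OF qw_pideal]) auto
  moreover have "A_sum p (p - 3) = A_star p 2 * (q * w - 1)"
  proof -
    have "p - 1 - 2 = p - 3" by simp
    then show ?thesis using A_star_A_sum[of 2] ge_7 by (simp only:)
  qed
  then have "A_star p 2 - (- A_sum p (p - 3) + q^2 * w * b) = q * w * (A_star p 2 - q * b)"
    by (simp add: algebra_simps power2_eq_square)
  ultimately show ?thesis by (simp add: padic_cong_iff b_def)
qed

end

theorem theorem2:
  fixes p :: nat
  assumes "prime p" and "p \<ge> 7"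
  shows "let q = (of_nat p :: rat); w = wilson_quotient p; g = agoh_giuga_quotient p in
    (\<forall>n::nat. 4 \<le> 2 * n \<and> 2 * n \<le> p - 7 \<longrightarrow>
      padic_cong p 4 (A_star p (2 * n))
        (- A_sum p (p - 1 - 2 * n)
         + q^2 * w * (1 + q * w) * divided_bernoulli (p - 1 - 2 * n)
         - q^3 * w / 2 * bernoulli_convolution (p - 1 - 2 * n)))
    \<and> padic_cong p 4 (A_star p 2)
        (- A_sum p (p - 3)
         + q^2 * w * (2 * divided_bernoulli (p - 3) - divided_bernoulli (2 * p - 4)))
    \<and> (p \<ge> 11 \<longrightarrow>
      padic_cong p 4 (A_star p (p - 5))
        (1/8 * (5 * q^3 / 4 - q / 15 - q^2 / 36)
         + q * w / 120 * (7 * q^2 / 12 - q * (1 + q * g))))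
    \<and> padic_cong p 4 (A_star p (p - 3))
        (1/24 * (q * (2 * q - 1) * (5 * q - 2)
                 + q * w * (2 * q - 11 * q^2 + 2 * q^2 * g)))
    \<and> padic_cong p 4 (A_star p (p - 1))
        (-1 + q * w * (3 * (q * divided_bernoulli (p - 1) - 1)
                       - q * divided_bernoulli (2 * (p - 1))
                       - 1/2 * q^2 * (divided_bernoulli (p - 1))^2))"
proof -
  interpret large_prime p using assms by unfold_locales
  show ?thesis
    unfolding Let_def
    using A_star_cong_generic A_star_cong_2 A_star_cong_p_minus_5 A_star_cong_p_minus_3
      A_star_cong_p_minus_1 by blast
qed

end
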